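(* Consider primes $p\to\infty$ together with divisors $m\mid p-1$ such that $d=(p-1)/m$ is odd and $\varphi(d)=o(\log p)$ as $p\to\infty$. Then for any constant $c<1$, \[ M_2(p,m)=\frac{\pi^2}{6}+O\big(p^{-c/\varphi(d)}\big),\qquad p\to\infty. \]
   Context: For a prime $p$ and $m\mid p-1$, $\mathcal{G}_m$ denotes the unique subgroup of $\mathbb{F}_p^*$ of index $m$; $\mathcal{X}_{p,m}$ is the group of multiplicative characters of $\mathbb{F}_p^*$ trivial on $\mathcal{G}_m$, and $\mathcal{X}_{p,m}^-=\{\chi\in\mathcal{X}_{p,m}:\chi(-1)=-1\}$. For a character $\chi$ modulo $p$ (viewed as a Dirichlet character), $L(1,\chi)=\sum_{n\ge1}\chi(n)/n$. For $m$ even and integers $\nu\ge1$, $M_\nu(p,m)=\frac{2}{m}\sum_{\chi\in\mathcal{X}_{p,m}^-}|L(1,\chi)|^\nu$. (Note $m$ is even when $d$ is odd and $p$ is odd.) $\varphi$ is Euler's totient function. *)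

theory Defs
  imports
    Complex_Main
    "HOL-Number_Theory.Number_Theory"
    "HOL-Algebra.Algebraic_Closure_Type"
    "HOL-Library.Landau_Symbols"
begin

definition Fp_units :: "nat \<Rightarrow> int monoid" where
  "Fp_units p = Multiplicative_Group.mult_of (residue_ring (int p))"

definition complex_units :: "complex monoid" where
  "complex_units = Multiplicative_Group.mult_of (ring_of_type_algebra :: complex ring)"

lemma Fp_units_explicit:
  assumes "Factorial_Ring.prime p"
  shows "carrier (Fp_units p) = {1..int p - 1}" "x \<otimes>\<^bsub>Fp_units p\<^esub> y = x * y mod int p"
    "\<ominus>\<^bsub>residue_ring (int p)\<^esub> \<one>\<^bsub>residue_ring (int p)\<^esub> = int p - 1"
proof -
  interpret residues_prime p "residue_ring (int p)"
    by unfold_locales (use assms in auto)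
  show "carrier (Fp_units p) = {1..int p - 1}" "x \<otimes>\<^bsub>Fp_units p\<^esub> y = x * y mod int p"
    by (auto simp: Fp_units_def Multiplicative_Group.mult_of_def residue_ring_def)
  show "\<ominus>\<^bsub>residue_ring (int p)\<^esub> \<one>\<^bsub>residue_ring (int p)\<^esub> = int p - 1"
    using prime_gt_1_nat[OF assms] by (simp add: res_neg_eq res_one_eq zmod_minus1)
qed

lemma complex_units_explicit:
  "carrier complex_units = UNIV - {0}" "x \<otimes>\<^bsub>complex_units\<^esub> y = x * y"
  by (auto simp: complex_units_def Multiplicative_Group.mult_of_def ring_of_type_algebra_def)

lemma Fp_units_group:
  assumes "Factorial_Ring.prime p"
  shows "group (Fp_units p)" "finite (carrier (Fp_units p))" "Coset.order (Fp_units p) = p - 1"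
proof -
  interpret residues_prime p "residue_ring (int p)"
    by unfold_locales (use assms in auto)
  show "group (Fp_units p)" unfolding Fp_units_def by (rule field_mult_group)
  show "finite (carrier (Fp_units p))" unfolding Fp_units_def by (simp add: Multiplicative_Group.mult_of_simps)
  show "Coset.order (Fp_units p) = p - 1" unfolding Fp_units_def order_mult_of[OF finite]
    by (simp add: Coset.order_def residue_ring_def)
qed

lemma ex1_index_subgroup:
  assumes p: "Factorial_Ring.prime p" and m: "m dvd p - 1"
  shows "\<exists>!H. subgroup H (Fp_units p) \<and> card (rcosets\<^bsub>Fp_units p\<^esub> H) = m"
proof -
  interpret residues_prime p "residue_ring (int p)"
    by unfold_locales (use p in auto)
  interpret G: group "Fp_units p" by (rule Fp_units_group[OF p])
  note fin = Fp_units_group(2)[OF p] and ord = Fp_units_group(3)[OF p]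
  have "p - 1 > 0" using prime_gt_1_nat[OF p] by simp
  define d where "d = (p - 1) div m"
  have md: "d * m = p - 1" using m by (simp add: d_def)
  have pos: "m > 0" "d > 0" using md \<open>p - 1 > 0\<close> by (auto intro: Nat.gr0I)
  define T where "T = {x \<in> carrier (residue_ring (int p)). x [^]\<^bsub>residue_ring (int p)\<^esub> d = \<one>\<^bsub>residue_ring (int p)\<^esub>}"
  have finT: "finite T" and cardT: "card T \<le> d"
    unfolding T_def using num_roots_le_deg[OF finite, of d] pos finite by auto
  have key: "H = T" if H: "subgroup H (Fp_units p)" "card H = d" for H
  proof (rule card_seteq[OF finT])
    show "card T \<le> card H" using cardT H by simp
    show "H \<subseteq> T"
    proof
      fix h assume h: "h \<in> H"
      have hc: "h \<in> carrier (Fp_units p)" using H h subgroup.subset by blast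
      interpret HG: group "(Fp_units p)\<lparr>carrier := H\<rparr>" by (rule subgroup.subgroup_is_group[OF H(1) G.is_group])
      have "h [^]\<^bsub>(Fp_units p)\<lparr>carrier := H\<rparr>\<^esub> d = \<one>\<^bsub>Fp_units p\<^esub>"
        using HG.pow_order_eq_1[of h] h H by (simp add: Coset.order_def)
      thus "h \<in> T" using hc unfolding T_def Fp_units_def
        by (simp add: nat_pow_def Multiplicative_Group.mult_of_def)
    qed
  qed
  have idx: "card (rcosets\<^bsub>Fp_units p\<^esub> H) = m \<longleftrightarrow> card H = d" if H: "subgroup H (Fp_units p)" for H
  proof -
    have "card (rcosets\<^bsub>Fp_units p\<^esub> H) * card H = d * m"
      using G.lagrange[OF H] ord md by simp
    thus ?thesis using pos by auto
  qed
  obtain a where a: "a \<in> carrier (Fp_units p)" "G.ord a = p - 1"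
  proof -
    obtain a where a: "a \<in> carrier (Fp_units p)"
      "carrier (Fp_units p) = {a [^]\<^bsub>residue_ring (int p)\<^esub> i | i::nat. i \<in> UNIV}"
      using finite_field_mult_group_has_gen[OF finite] unfolding Fp_units_def by auto
    have "carrier (Fp_units p) = generate (Fp_units p) {a}"
      using a G.generate_pow_on_finite_carrier[OF fin a(1)]
      by (simp add: Fp_units_def Multiplicative_Group.nat_pow_mult_of image_def) 
    hence "G.ord a = p - 1" using G.generate_pow_card[OF a(1)] ord by (simp add: Coset.order_def)
    thus ?thesis using that a by blast
  qed
  define b where "b = a [^]\<^bsub>Fp_units p\<^esub> m"
  have b: "b \<in> carrier (Fp_units p)" using a by (simp add: b_def)
  have "G.ord b = d"
    unfolding b_def d_def using a m pos by (simp add: G.ord_pow)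
  hence "card (generate (Fp_units p) {b}) = d" using G.generate_pow_card[OF b] by simp
  moreover have "subgroup (generate (Fp_units p) {b}) (Fp_units p)"
    using b by (intro G.generate_is_subgroup) auto
  ultimately show ?thesis using key idx by metis
qed

(* Proper by ex1_index_subgroup for p prime and m dvd p - 1. *)
definition index_subgroup :: "nat \<Rightarrow> nat \<Rightarrow> int set" where
  "index_subgroup p m =
     (THE H. subgroup H (Fp_units p) \<and> card (rcosets\<^bsub>Fp_units p\<^esub> H) = m)"

(* hom leaves the values outside the carrier unconstrained; extensionality fixes them, so that
   every character is represented by exactly one function and sums over characters are
   meaningful. *)
definition mult_chars :: "nat \<Rightarrow> (int \<Rightarrow> complex) set" where
  "mult_chars p = hom (Fp_units p) complex_units \<inter> extensional (carrier (Fp_units p))"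

definition chars_trivial_on :: "nat \<Rightarrow> nat \<Rightarrow> (int \<Rightarrow> complex) set" where
  "chars_trivial_on p m = {\<chi> \<in> mult_chars p. \<forall>x \<in> index_subgroup p m. \<chi> x = 1}"

definition odd_chars_trivial_on :: "nat \<Rightarrow> nat \<Rightarrow> (int \<Rightarrow> complex) set" where
  "odd_chars_trivial_on p m =
     {\<chi> \<in> chars_trivial_on p m.
        \<chi> (\<ominus>\<^bsub>residue_ring (int p)\<^esub> \<one>\<^bsub>residue_ring (int p)\<^esub>) = -1}"

definition dirichlet_char :: "nat \<Rightarrow> (int \<Rightarrow> complex) \<Rightarrow> nat \<Rightarrow> complex" where
  "dirichlet_char p \<chi> n = (if p dvd n then 0 else \<chi> (int n mod int p))"

(* The sum over n >= 1, taken in increasing order: it is only conditionally convergent. *)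
definition L_one :: "nat \<Rightarrow> (int \<Rightarrow> complex) \<Rightarrow> complex" where
  "L_one p \<chi> = (\<Sum>n. dirichlet_char p \<chi> (Suc n) / of_nat (Suc n))"

definition moment :: "nat \<Rightarrow> nat \<Rightarrow> nat \<Rightarrow> real" where
  "moment \<nu> p m =
     2 / real m * (\<Sum>\<chi> \<in> odd_chars_trivial_on p m. norm (L_one p \<chi>) ^ \<nu>)"

end

theory Submission
  imports
    Defs
    "HOL-Analysis.Analysis"
    "HOL-Real_Asymp.Real_Asymp"
begin

text \<open>
  For odd \<open>\<chi>\<close> one has \<open>L(1,\<chi>) = \<pi>/(2p) \<Sum>\<^sub>x \<chi>(x) cot(\<pi>x/p)\<close>, so orthogonality of the odd
  characters trivial on the subgroup \<open>H\<close> of order \<open>d\<close> turns the second moment into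
  \<open>\<pi>\<^sup>2/(2p\<^sup>2) \<Sum>\<^bsub>h\<in>H\<^esub> \<Sum>\<^sub>x cot(\<pi>x/p) cot(\<pi>hx/p)\<close>. The term \<open>h = 1\<close> gives \<open>\<pi>\<^sup>2/6 + O(1/p)\<close>.
  For \<open>h \<noteq> 1\<close> write \<open>h \<equiv> y/x\<close> with coprime \<open>x, \<bar>y\<bar> \<le> \<surd>p\<close> (Thue); the term is
  \<open>O(1/(x\<bar>y\<bar>) + log p/\<surd>p)\<close>. As \<open>p\<close> divides the nonzero value at \<open>(x,y)\<close> of some homogenised
  cyclotomic polynomial of index dividing \<open>d\<close>, \<open>x\<bar>y\<bar>\<close> is at least \<open>X/2\<close>, where
  \<open>X = p\<^bsup>1/\<phi>(d)\<^esup>\<close>.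

  Summing \<open>1/X\<close> over all \<open>h\<close> would lose a factor \<open>d\<close>. Fractions \<open>y/x\<close> with \<open>x\<close> or \<open>\<bar>y\<bar>\<close> above
  \<open>L = p\<^bsup>1/(5\<surd>d)\<^esup>\<close> are harmless, since \<open>L\<close> exceeds every power of \<open>d\<close>. For two of the remaining
  ones, more than \<open>d\<close> monomials of exponents at most \<open>\<surd>d\<close> take values in \<open>H\<close>, so two of
  them agree modulo \<open>p\<close> and, by size, in the rationals. Hence all small fractions are pairwise
  multiplicatively dependent, a fixed \<open>q\<close>-adic valuation \<open>v\<close> is injective and nonzero on them, and
  \<open>x\<bar>y\<bar> \<ge> 2\<^bsup>\<bar>v\<bar>\<^esup>\<close> makes the sum over them geometric.
\<close>

section \<open>Cyclotomic polynomials and small representatives\<close>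

text \<open>The elements of exact order n. At n = 0 both conditions are vacuous and the set is all
  of the complex numbers, hence the positivity assumptions below.\<close>

definition primitive_roots_unity :: "nat \<Rightarrow> complex set" where
  "primitive_roots_unity n = {z. z ^ n = 1 \<and> (\<forall>k. 0 < k \<and> k < n \<longrightarrow> z ^ k \<noteq> 1)}"

text \<open>Built from its complex roots, so that monicity, the degree and a bound for its values
  come directly; integrality of the coefficients is then a separate matter.\<close>

definition cyclotomic :: "nat \<Rightarrow> complex poly" where
  "cyclotomic n = (\<Prod>z\<in>primitive_roots_unity n. [:- z, 1:])"

lemma finite_primitive_roots_unity [simp]: "n > 0 \<Longrightarrow> finite (primitive_roots_unity n)"
  using finite_nth_roots[of n 1] by (auto simp: primitive_roots_unity_def elim: finite_subset[rotated])

lemma roots_unity_eq_Union_primitive: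
  assumes "n > 0"
  shows "{z::complex. z ^ n = 1} = (\<Union>d\<in>{d. d dvd n}. primitive_roots_unity d)"
proof (intro equalityI subsetI)
  fix z :: complex assume z: "z \<in> {z. z ^ n = 1}"
  define d where "d = (LEAST k. k > 0 \<and> z ^ k = 1)"
  have d: "d > 0" "z ^ d = 1"
    using LeastI_ex[of "\<lambda>k. k > 0 \<and> z ^ k = 1"] z assms unfolding d_def by auto
  have least: "z ^ k \<noteq> 1" if "0 < k" "k < d" for k
    using not_less_Least[of k "\<lambda>k. k > 0 \<and> z ^ k = 1"] that unfolding d_def by auto
  have "z ^ (d * (n div d) + n mod d) = z ^ (n mod d)"
    unfolding power_add power_mult d(2) by simp
  hence "z ^ (n mod d) = 1" using z by simp
  hence "n mod d = 0" using least[of "n mod d"] d by auto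
  thus "z \<in> (\<Union>d\<in>{d. d dvd n}. primitive_roots_unity d)"
    using d least by (auto simp: primitive_roots_unity_def)
next
  fix z assume "z \<in> (\<Union>d\<in>{d. d dvd n}. primitive_roots_unity d)"
  thus "z \<in> {z. z ^ n = 1}"
    by (auto simp: primitive_roots_unity_def power_mult elim!: dvdE)
qed

lemma primitive_roots_unity_disjoint:
  assumes "a > 0" "b > 0" "a \<noteq> b"
  shows "primitive_roots_unity a \<inter> primitive_roots_unity b = {}"
proof (cases "a < b")
  case True
  thus ?thesis using assms by (auto simp: primitive_roots_unity_def)
next
  case False
  hence "b < a" using assms by simp
  thus ?thesis using assms by (auto simp: primitive_roots_unity_def)
qed

text \<open>Sorting the n-th roots of unity by exact order gives the same divisor-sum identity that
  the totient satisfies; strong induction cancels the proper divisors.\<close>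

lemma card_primitive_roots_unity:
  "n > 0 \<Longrightarrow> card (primitive_roots_unity n) = totient n"
proof (induction n rule: less_induct)
  case (less n)
  have fin: "finite {d. d dvd n}" using less.prems by simp
  have pos: "d > 0" if "d dvd n" for d using that less.prems by (auto intro: Nat.gr0I)
  have "n = card {z::complex. z ^ n = 1}" using card_nth_roots[of 1 n] less.prems by simp
  also have "\<dots> = (\<Sum>d | d dvd n. card (primitive_roots_unity d))"
    unfolding roots_unity_eq_Union_primitive[OF less.prems]
    by (rule card_UN_disjoint[OF fin]) (use pos primitive_roots_unity_disjoint in auto)
  also have "\<dots> = card (primitive_roots_unity n) + (\<Sum>d\<in>{d. d dvd n} - {n}. card (primitive_roots_unity d))"
    by (rule sum.remove[OF fin]) simp
  also have "(\<Sum>d\<in>{d. d dvd n} - {n}. card (primitive_roots_unity d)) = (\<Sum>d\<in>{d. d dvd n} - {n}. totient d)"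
  proof (intro sum.cong refl)
    fix d assume "d \<in> {d. d dvd n} - {n}"
    hence d: "d dvd n" "d \<noteq> n" by auto
    have "d < n" using dvd_imp_le[OF d(1) less.prems] d(2) by linarith
    thus "card (primitive_roots_unity d) = totient d" using pos[OF d(1)] by (rule less.IH)
  qed
  finally have "n = card (primitive_roots_unity n) + (\<Sum>d\<in>{d. d dvd n} - {n}. totient d)" .
  moreover have "n = totient n + (\<Sum>d\<in>{d. d dvd n} - {n}. totient d)"
    using sum.remove[OF fin, of n totient] totient_divisor_sum[of n] by simp
  ultimately show ?case by linarith
qed

lemma degree_cyclotomic: "n > 0 \<Longrightarrow> degree (cyclotomic n) = totient n"
  unfolding cyclotomic_def by (subst degree_prod_eq_sum_degree) (auto simp: card_primitive_roots_unity)

lemma monic_cyclotomic: "lead_coeff (cyclotomic n) = 1"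
  unfolding cyclotomic_def by (subst lead_coeff_prod) auto

lemma prod_cyclotomic:
  assumes "n > 0"
  shows "(\<Prod>d | d dvd n. cyclotomic d) = monom 1 n - 1"
proof -
  have fin: "finite {d. d dvd n}" using assms by simp
  have pos: "d > 0" if "d dvd n" for d using that assms by (auto intro: Nat.gr0I)
  let ?p = "\<Prod>d | d dvd n. cyclotomic d"
  have p: "?p = (\<Prod>z\<in>{z. z ^ n = 1}. [:- z, 1:])"
    unfolding cyclotomic_def roots_unity_eq_Union_primitive[OF assms]
    by (rule prod.UNION_disjoint[symmetric, OF fin]) (use pos primitive_roots_unity_disjoint in auto)
  have finr: "finite {z::complex. z ^ n = 1}" using finite_nth_roots[of n 1] assms by simp
  have cardr: "card {z::complex. z ^ n = 1} = n" using card_nth_roots[of 1 n] assms by simp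
  have "monom 1 n - 1 - ?p = 0"
  proof (rule ccontr)
    \<comment> \<open>Both sides are monic of degree n, so a nonzero difference has degree below n;
      yet it vanishes at all n distinct roots of unity.\<close>
    assume nz: "monom 1 n - 1 - ?p \<noteq> 0"
    have dp: "degree ?p = n" unfolding p using cardr
      by (subst degree_prod_eq_sum_degree) auto
    have "lead_coeff ?p = 1" by (simp add: lead_coeff_prod monic_cyclotomic)
    hence cp: "coeff ?p n = 1" using dp by simp
    have "degree (monom 1 n - 1 - ?p) \<le> n"
      using dp by (intro degree_diff_le) (auto simp: degree_monom_eq)
    moreover have "coeff (monom 1 n - 1 - ?p) n = 0" using cp assms by (simp add: coeff_1)
    ultimately have "degree (monom 1 n - 1 - ?p) < n"
      using nz by (metis leading_coeff_0_iff le_neq_implies_less)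
    moreover have "card {z. poly (monom 1 n - 1 - ?p) z = 0} \<le> degree (monom 1 n - 1 - ?p)"
      by (rule card_poly_roots_bound[OF nz])
    moreover have "{z. z ^ n = 1} \<subseteq> {z. poly (monom 1 n - 1 - ?p) z = 0}"
      using finr by (auto simp: p poly_monom poly_prod)
    hence "n \<le> card {z. poly (monom 1 n - 1 - ?p) z = 0}"
      using card_mono[OF poly_roots_finite[OF nz]] cardr by metis
    ultimately show False by linarith
  qed
  thus ?thesis by simp
qed

section \<open>Integrality of cyclotomic coefficients and the resulting height bound\<close>

lemma Ints_coeff_mult:
  fixes a b :: "'a :: comm_ring_1 poly"
  assumes "\<And>i. coeff a i \<in> \<int>" "\<And>i. coeff b i \<in> \<int>"
  shows "coeff (a * b) i \<in> \<int>"
  unfolding coeff_mult using assms by (intro Ints_sum Ints_mult) auto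

lemma Ints_coeff_prod:
  fixes f :: "'b \<Rightarrow> 'a :: comm_ring_1 poly"
  assumes "\<And>x i. x \<in> A \<Longrightarrow> coeff (f x) i \<in> \<int>"
  shows "coeff (\<Prod>x\<in>A. f x) i \<in> \<int>"
  using assms
proof (induction A arbitrary: i rule: infinite_finite_induct)
  case (insert x A)
  thus ?case by (simp add: Ints_coeff_mult)
qed (auto simp: coeff_1)

text \<open>Division by a monic polynomial does not leave the integers. The coefficient of index
  \<open>degree a + i\<close> in the product is \<open>coeff b i\<close> plus terms in higher
  coefficients of \<open>b\<close> only, so descending induction on \<open>i\<close>
  applies.\<close>

lemma Ints_coeff_quotient:
  fixes a b :: "'a :: comm_ring_1 poly"
  assumes a: "\<And>i. coeff a i \<in> \<int>" and ab: "\<And>i. coeff (a * b) i \<in> \<int>" and "lead_coeff a = 1"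
  shows "coeff b i \<in> \<int>"
proof (induction "degree b - i" arbitrary: i rule: less_induct)
  case less
  show ?case
  proof (cases "i \<le> degree b")
    case True
    let ?D = "degree a"
    have "coeff (a * b) (?D + i) = (\<Sum>k\<le>?D + i. coeff a k * coeff b (?D + i - k))"
      by (simp add: coeff_mult)
    also have "\<dots> = coeff a ?D * coeff b i + (\<Sum>k\<in>{..?D + i} - {?D}. coeff a k * coeff b (?D + i - k))"
      by (subst sum.remove[of _ ?D]) auto
    finally have eq: "coeff b i = coeff (a * b) (?D + i) - (\<Sum>k\<in>{..?D + i} - {?D}. coeff a k * coeff b (?D + i - k))"
      using assms(3) by simp
    have "coeff a k * coeff b (?D + i - k) \<in> \<int>" if "k \<in> {..?D + i} - {?D}" for k
    proof (cases "k > ?D")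
      case True
      thus ?thesis by (simp add: coeff_eq_0)
    next
      case False
      hence "?D + i - k > i" using that by auto
      have "coeff b (?D + i - k) \<in> \<int>"
      proof (cases "?D + i - k \<le> degree b")
        case True
        thus ?thesis using \<open>?D + i - k > i\<close> by (intro less) linarith
      qed (simp add: coeff_eq_0)
      thus ?thesis using a by (intro Ints_mult)
    qed
    thus ?thesis unfolding eq using ab by (intro Ints_diff Ints_sum) auto
  qed (simp add: coeff_eq_0)
qed

text \<open>Strong induction: \<open>cyclotomic n\<close> is the quotient of X^n - 1 by the product
  over proper divisors, which is monic with integer coefficients.\<close>

lemma Ints_coeff_cyclotomic: "n > 0 \<Longrightarrow> coeff (cyclotomic n) i \<in> \<int>"
proof (induction n arbitrary: i rule: less_induct)
  case (less n)
  have fin: "finite {d. d dvd n}" using less.prems by simp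
  let ?R = "\<Prod>d\<in>{d. d dvd n} - {n}. cyclotomic d"
  have eq: "?R * cyclotomic n = monom 1 n - 1"
    using prod.remove[OF fin, of n cyclotomic] prod_cyclotomic[OF less.prems] by (simp add: mult.commute)
  show ?case
  proof (rule Ints_coeff_quotient)
    show "coeff ?R i \<in> \<int>" for i
    proof (rule Ints_coeff_prod)
      fix d j assume "d \<in> {d. d dvd n} - {n}"
      hence d: "d dvd n" "d \<noteq> n" by auto
      have "d < n" using dvd_imp_le[OF d(1) less.prems] d(2) by linarith
      moreover have "d > 0" using d(1) less.prems by (auto intro: Nat.gr0I)
      ultimately show "coeff (cyclotomic d) j \<in> \<int>" by (rule less.IH)
    qed
    show "coeff (?R * cyclotomic n) i \<in> \<int>" for i
      unfolding eq by (auto simp: coeff_1)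
    show "lead_coeff ?R = 1" by (simp add: lead_coeff_prod monic_cyclotomic)
  qed
qed

text \<open>The prime divides \<open>h ^ d - 1\<close>, a product of cyclotomic values at
  \<open>h\<close>, hence one of them, of index \<open>f\<close> dividing \<open>d\<close>.
  Multiplied by a power of \<open>x\<close>, that value is congruent to a form \<open>N\<close> in
  \<open>x\<close> and \<open>y\<close>: a nonzero multiple of \<open>p\<close> with
  \<open>totient f\<close> linear factors, each of modulus at most |x| + |y|.\<close>

lemma prime_le_power_totient:
  fixes p d :: nat and h x y :: int
  assumes p: "Factorial_Ring.prime p" and d: "odd d" and hd: "[h ^ d = 1] (mod int p)" and h1: "\<not> [h = 1] (mod int p)"
    and y: "[y = h * x] (mod int p)" and x: "\<not> int p dvd x"
  shows "real p \<le> (\<bar>x\<bar> + \<bar>y\<bar>) ^ totient d"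
proof -
  have p': "Factorial_Ring.prime (int p)" using p by simp
  have d0: "d > 0" using d by (auto intro: Nat.gr0I)
  have x0: "x \<noteq> 0" using x by auto
  have pos: "f > 0" if "f dvd d" for f using that d0 by (auto intro: Nat.gr0I)
  \<comment> \<open>The coefficients are so far integers only inside the complex numbers; the floor
    of the real part recovers them in \<open>int\<close>.\<close>
  define a where "a = (\<lambda>f i. \<lfloor>Re (coeff (cyclotomic f) i)\<rfloor>)"
  have a: "coeff (cyclotomic f) i = of_int (a f i)" if "f dvd d" for f i
    using Ints_coeff_cyclotomic[OF pos[OF that], of i] unfolding a_def by (auto elim!: Ints_cases)
  define E where "E = (\<lambda>f. \<Sum>i\<le>totient f. a f i * h ^ i)"
  have E: "poly (cyclotomic f) (of_int h) = of_int (E f)" if "f dvd d" for f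
    unfolding poly_altdef E_def using that degree_cyclotomic[OF pos[OF that]] by (simp add: a)
  have "(of_int (\<Prod>f | f dvd d. E f) :: complex) = of_int (h ^ d - 1)"
  proof -
    have "of_int (\<Prod>f | f dvd d. E f) = (\<Prod>f | f dvd d. poly (cyclotomic f) (of_int h))"
      by (simp add: E)
    also have "\<dots> = poly (monom 1 d - 1) (of_int h)"
      using prod_cyclotomic[OF d0] by (simp flip: poly_prod)
    finally show ?thesis by (simp add: poly_monom)
  qed
  hence "(\<Prod>f | f dvd d. E f) = h ^ d - 1" by (simp only: of_int_eq_iff)
  moreover have "int p dvd h ^ d - 1" using hd by (simp add: cong_iff_dvd_diff)
  ultimately have "int p dvd (\<Prod>f | f dvd d. E f)" by simp
  then obtain f where f: "f dvd d" "int p dvd E f"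
    using p' d0 by (subst (asm) prime_dvd_prod_iff) auto
  have f0: "f > 0" using f pos by simp
  have "odd f" using f d by (metis dvd_trans)
  \<comment> \<open>The homogenised cyclotomic polynomial of index \<open>f\<close>, a polynomial
    expression that makes sense modulo p.\<close>
  define N where "N = (\<Sum>i\<le>totient f. a f i * y ^ i * x ^ (totient f - i))"
  have "[N = (\<Sum>i\<le>totient f. x ^ totient f * (a f i * h ^ i))] (mod int p)"
    unfolding N_def
  proof (rule cong_sum)
    fix i assume "i \<in> {..totient f}"
    have "[a f i * y ^ i * x ^ (totient f - i) = a f i * (h * x) ^ i * x ^ (totient f - i)] (mod int p)"
      by (intro cong_mult cong_pow y cong_refl)
    also have "a f i * (h * x) ^ i * x ^ (totient f - i) = a f i * h ^ i * x ^ (i + (totient f - i))"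
      by (simp only: power_add power_mult_distrib mult_ac)
    finally show "[a f i * y ^ i * x ^ (totient f - i) = x ^ totient f * (a f i * h ^ i)] (mod int p)"
      using \<open>i \<in> _\<close> by (simp add: mult_ac)
  qed
  hence "[N = x ^ totient f * E f] (mod int p)" by (simp add: E_def sum_distrib_left)
  hence pN: "int p dvd N" using f(2) by (simp add: cong_dvd_iff)
  have N: "of_int N = (\<Prod>z\<in>primitive_roots_unity f. of_int y - z * of_int x :: complex)"
  proof -
    have "of_int N = of_int x ^ totient f * poly (cyclotomic f) (of_int y / of_int x :: complex)"
      unfolding N_def poly_altdef degree_cyclotomic[OF f0] of_int_sum sum_distrib_left
    proof (intro sum.cong refl)
      fix i assume "i \<in> {..totient f}"
      hence "(of_int x :: complex) ^ totient f = of_int x ^ i * of_int x ^ (totient f - i)"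
        by (simp flip: power_add)
      thus "of_int (a f i * y ^ i * x ^ (totient f - i))
          = of_int x ^ totient f * (coeff (cyclotomic f) i * (of_int y / of_int x :: complex) ^ i)"
        using x0 by (simp add: a[OF f(1)] power_divide)
    qed
    also have "\<dots> = (\<Prod>z\<in>primitive_roots_unity f. of_int x * (of_int y / of_int x - z))"
      by (simp add: cyclotomic_def poly_prod prod.distrib card_primitive_roots_unity f0)
    also have "\<dots> = (\<Prod>z\<in>primitive_roots_unity f. of_int y - z * of_int x)"
      using x0 by (intro prod.cong) (auto simp: field_simps)
    finally show ?thesis .
  qed
  \<comment> \<open>A vanishing factor would make y/x an f-th root of unity. Being real with
    \<open>f\<close> odd it equals 1, which forces h = 1 modulo p.\<close>
  have "N \<noteq> 0"
  proof
    assume "N = 0"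
    then obtain z where z: "z \<in> primitive_roots_unity f" "of_int y = z * of_int x"
      using N f0 by auto
    have "(of_int y :: complex) ^ f = of_int x ^ f"
      using z by (simp add: power_mult_distrib primitive_roots_unity_def)
    hence "y ^ f = x ^ f" by (metis of_int_eq_iff of_int_power)
    hence "real_of_int y ^ f = real_of_int x ^ f" by (metis of_int_power)
    hence "y = x" using odd_real_root_power_cancel[OF \<open>odd f\<close>] by (metis of_int_eq_iff)
    hence "int p dvd (h - 1) * x" using y by (simp add: cong_iff_dvd_diff algebra_simps dvd_diff_commute)
    thus False using p' x h1 by (auto simp: prime_dvd_mult_iff cong_iff_dvd_diff)
  qed
  hence "int p \<le> \<bar>N\<bar>" using pN by (intro zdvd_imp_le) auto
  hence "real p \<le> real_of_int \<bar>N\<bar>" by linarith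
  also have "\<dots> = norm (of_int N :: complex)" by simp
  also have "\<dots> \<le> (\<Prod>z\<in>primitive_roots_unity f. real_of_int (\<bar>x\<bar> + \<bar>y\<bar>))"
    unfolding N prod_norm[symmetric]
  proof (intro prod_mono conjI norm_ge_zero)
    fix z assume z: "z \<in> primitive_roots_unity f"
    have "norm z = 1" using z f0 power_eq_1_iff[of z f] by (auto simp: primitive_roots_unity_def)
    thus "norm (of_int y - z * of_int x) \<le> real_of_int (\<bar>x\<bar> + \<bar>y\<bar>)"
      using norm_triangle_ineq4[of "of_int y" "z * of_int x"] by (simp add: norm_mult)
  qed
  also have "\<dots> = real_of_int ((\<bar>x\<bar> + \<bar>y\<bar>) ^ totient f)" by (simp add: card_primitive_roots_unity f0)
  also have "\<dots> \<le> real_of_int ((\<bar>x\<bar> + \<bar>y\<bar>) ^ totient d)"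
  proof -
    have "totient f \<le> totient d" using totient_dvd_mono[OF f(1)] d0 by (simp add: dvd_imp_le)
    moreover have "1 \<le> \<bar>x\<bar> + \<bar>y\<bar>" using x0 by linarith
    ultimately have "(\<bar>x\<bar> + \<bar>y\<bar>) ^ totient f \<le> (\<bar>x\<bar> + \<bar>y\<bar>) ^ totient d" by (rule power_increasing)
    thus ?thesis by linarith
  qed
  finally show ?thesis by simp
qed

text \<open>Any exponent above \<open>1/2\<close> in place of \<open>3/5\<close> would do: it makes \<open>log p / \<surd>d\<close> grow like a power of \<open>d\<close>.\<close>
lemma odd_cube_le_totient_power5:
  assumes "odd n" shows "n ^ 3 \<le> totient n ^ 5"
proof -
  have n0: "n > 0" using assms by (auto intro: Nat.gr0I)
  have "n = (\<Prod>q\<in>prime_factors n. q ^ multiplicity q n)"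
    using prod_prime_factors[of n] n0 by simp
  hence "n ^ 3 = (\<Prod>q\<in>prime_factors n. (q ^ multiplicity q n) ^ 3)"
    by (metis prod_power_distrib)
  also have "\<dots> \<le> (\<Prod>q\<in>prime_factors n. (q ^ (multiplicity q n - 1) * (q - 1)) ^ 5)"
  proof (rule prod_mono, intro conjI)
    fix q assume q: "q \<in> prime_factors n"
    have pr: "Factorial_Ring.prime q" "q dvd n" using q by auto
    have "q \<noteq> 2" using pr assms by auto
    hence q3: "q \<ge> 3" using prime_ge_2_nat[OF pr(1)] by linarith
    obtain k where k: "multiplicity q n = Suc k"
      using q by (metis not0_implies_Suc prime_factors_multiplicity mem_Collect_eq neq0_conv)
    \<comment> \<open>From q >= 3: 2q <= 3(q - 1) gives 8q^3 <= 27(q - 1)^3, and (q - 1)^2 >= 4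
      bounds the right side by (27/4)(q - 1)^5.\<close>
    have "q ^ 3 \<le> (q - 1) ^ 5"
    proof -
      have "(2 * q) ^ 3 \<le> (3 * (q - 1)) ^ 3" using q3 by (intro power_mono) auto
      hence "8 * q ^ 3 \<le> 27 * (q - 1) ^ 3" by (simp add: power_mult_distrib)
      moreover have "(2::nat) ^ 2 \<le> (q - 1) ^ 2" using q3 by (intro power_mono) auto
      hence "4 * (q - 1) ^ 3 \<le> (q - 1) ^ 2 * (q - 1) ^ 3" by (intro mult_right_mono) auto
      ultimately show ?thesis by (simp flip: power_add)
    qed
    hence "(q ^ k) ^ 3 * q ^ 3 \<le> (q ^ k) ^ 5 * (q - 1) ^ 5"
      using q3 by (intro mult_mono power_increasing) auto
    thus "(q ^ multiplicity q n) ^ 3 \<le> (q ^ (multiplicity q n - 1) * (q - 1)) ^ 5"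
      by (simp add: k power_mult_distrib mult.commute)
  qed simp
  also have "\<dots> = totient n ^ 5"
    unfolding totient_formula1[OF n0] by (simp add: prod_power_distrib)
  finally show ?thesis .
qed

section \<open>Multiplicative dependence of small fractions\<close>

text \<open>When d divides p - 1 this is the subgroup of order d (see
  \<open>index_subgroup_eq\<close>), described by representatives so that plain congruence arguments
  apply.\<close>

definition unity_roots_mod :: "nat \<Rightarrow> nat \<Rightarrow> int set" where
  "unity_roots_mod p d = {h \<in> {1..int p - 1}. [h ^ d = 1] (mod int p)}"

lemma unity_roots_mod_mult:
  assumes "Factorial_Ring.prime p" "[g ^ d = 1] (mod int p)" "[h ^ d = 1] (mod int p)" "d > 0"
  shows "g * h mod int p \<in> unity_roots_mod p d"
proof -
  have p1: "int p > 1" using prime_gt_1_nat[OF assms(1)] by simp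
  have gh: "[(g * h) ^ d = 1] (mod int p)"
    using cong_mult[OF assms(2,3)] by (simp add: power_mult_distrib)
  hence "[(g * h mod int p) ^ d = 1] (mod int p)"
    using cong_trans[OF cong_pow[of "g * h mod int p" "g * h" "int p" d] gh] by simp
  moreover have "g * h mod int p \<noteq> 0"
  proof
    assume "g * h mod int p = 0"
    hence "[(g * h) ^ d = 0 ^ d] (mod int p)" by (intro cong_pow) (simp add: Cong.cong_def)
    hence "[1 = 0] (mod int p)" using gh \<open>d > 0\<close> by (metis cong_sym cong_trans zero_power)
    thus False using p1 by (simp add: Cong.cong_def)
  qed
  moreover have "0 \<le> g * h mod int p" "g * h mod int p < int p" using p1 by simp_all
  ultimately have "1 \<le> g * h mod int p \<and> g * h mod int p \<le> int p - 1" by linarith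
  with \<open>[(g * h mod int p) ^ d = 1] (mod int p)\<close> show ?thesis
    unfolding unity_roots_mod_def by simp
qed

lemma unity_roots_mod_power:
  assumes "h \<in> unity_roots_mod p d"
  shows "[(h ^ i) ^ d = 1] (mod int p)"
proof -
  have "[(h ^ d) ^ i = 1 ^ i] (mod int p)"
    using assms by (intro cong_pow) (simp add: unity_roots_mod_def)
  thus ?thesis by (simp add: power_mult[symmetric] mult.commute)
qed

text \<open>Raising to the odd power d would give 1 = -1 modulo p. This is what permits comparing
  fractions by absolute value only.\<close>

lemma cong_minus_unity_roots_mod:
  assumes "Factorial_Ring.prime p" "odd p" "odd d" "g \<in> unity_roots_mod p d" "h \<in> unity_roots_mod p d"
  shows "\<not> [g = - h] (mod int p)"
proof
  assume "[g = - h] (mod int p)"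
  hence "[g ^ d = (- h) ^ d] (mod int p)" by (rule cong_pow)
  hence "[g ^ d = - (h ^ d)] (mod int p)" using assms(3) by simp
  hence "[1 = - 1] (mod int p)"
    using unity_roots_mod_power[OF assms(4), of 1] unity_roots_mod_power[OF assms(5), of 1]
    by (metis cong_minus_minus_iff cong_sym cong_trans power_one_right)
  hence "int p dvd 2" by (simp add: cong_iff_dvd_diff)
  hence "int p \<le> 2" by (rule zdvd_imp_le) simp
  thus False using assms(1,2) prime_ge_2_nat[of p] by (cases "p = 2") auto
qed

text \<open>Every h in \<open>S\<close> is represented by a fraction y/x with entries at most
  \<open>L\<close>. There are more pairs of exponents up to \<open>t\<close> than d-th roots of
  unity, and \<open>L\<close> is so small that products of four powers with exponents at most
  \<open>t\<close> stay below p/2.\<close>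

locale unity_fractions =
  fixes p d t :: nat and L :: real and S :: "int set" and x y :: "int \<Rightarrow> int"
  assumes p: "Factorial_Ring.prime p" "odd p" and d: "odd d"
    and card_roots: "card (unity_roots_mod p d) < (t + 1)\<^sup>2"
    and L: "2 * L ^ (4 * t) < p"
    and S: "S \<subseteq> unity_roots_mod p d - {1}"
    and x: "\<And>h. h \<in> S \<Longrightarrow> 0 < x h \<and> x h \<le> L"
    and y: "\<And>h. h \<in> S \<Longrightarrow> y h \<noteq> 0 \<and> \<bar>y h\<bar> \<le> L"
    and coprime: "\<And>h. h \<in> S \<Longrightarrow> coprime (x h) (y h)"
    and cong: "\<And>h. h \<in> S \<Longrightarrow> [y h = h * x h] (mod int p)"
begin

lemma small_monomial:
  assumes "g \<in> S" "h \<in> S" "i \<le> t" "i' \<le> t" "j \<le> t" "j' \<le> t"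
  shows "2 * \<bar>y g ^ i * x g ^ i' * (y h ^ j * x h ^ j')\<bar> < p"
proof -
  have L1: "1 \<le> L" using x[OF assms(1)] by linarith
  have pow: "\<bar>real_of_int z ^ k\<bar> \<le> L ^ t" if "\<bar>z\<bar> \<le> L" "k \<le> t" for z k
  proof -
    have "\<bar>real_of_int z ^ k\<bar> \<le> L ^ k" using that(1) by (simp add: power_abs power_mono)
    also have "\<dots> \<le> L ^ t" by (rule power_increasing[OF that(2) L1])
    finally show ?thesis .
  qed
  have "real_of_int \<bar>y g ^ i * x g ^ i' * (y h ^ j * x h ^ j')\<bar>
      = \<bar>real_of_int (y g) ^ i\<bar> * \<bar>real_of_int (x g) ^ i'\<bar> * (\<bar>real_of_int (y h) ^ j\<bar> * \<bar>real_of_int (x h) ^ j'\<bar>)"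
    by (simp add: abs_mult)
  also have "\<dots> \<le> (L ^ t * L ^ t) * (L ^ t * L ^ t)"
    using x y assms L1 by (intro mult_mono pow mult_nonneg_nonneg abs_ge_zero zero_le_power) (auto simp: less_imp_le)
  also have "\<dots> = L ^ (4 * t)" by (simp add: power_add[symmetric]) (simp add: numeral_eq_Suc algebra_simps)
  finally have "real_of_int (2 * \<bar>y g ^ i * x g ^ i' * (y h ^ j * x h ^ j')\<bar>) < real_of_int (int p)"
    using L by simp
  thus ?thesis by linarith
qed

text \<open>Pigeonhole on exponent pairs yields a relation g^i h^j = g^i' h^j' modulo p. With
  denominators cleared, both sides are below p/2 in absolute value, so the relation holds in the
  integers: the fractions of g and h are multiplicatively dependent.\<close>

lemma dependent:
  assumes g: "g \<in> S" and h: "h \<in> S"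
  obtains i i' j j' where "i \<noteq> i' \<or> j \<noteq> j'"
    "y g ^ i * x g ^ i' * (y h ^ j * x h ^ j') = y g ^ i' * x g ^ i * (y h ^ j' * x h ^ j)"
proof -
  have d0: "d > 0" using d by (auto intro: Nat.gr0I)
  let ?f = "\<lambda>(i, j). g ^ i * h ^ j mod int p"
  have "?f ` ({..t} \<times> {..t}) \<subseteq> unity_roots_mod p d"
    using S g h by (auto intro!: unity_roots_mod_mult[OF p(1) _ _ d0] unity_roots_mod_power)
  moreover have "finite (unity_roots_mod p d)"
    by (rule finite_subset[of _ "{1..int p - 1}"]) (auto simp: unity_roots_mod_def)
  ultimately have "card (?f ` ({..t} \<times> {..t})) \<le> card (unity_roots_mod p d)" by (rule card_mono[rotated])
  also have "\<dots> < card ({..t} \<times> {..t})" using card_roots by (simp add: card_cartesian_product power2_eq_square)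
  finally have "\<not> inj_on ?f ({..t} \<times> {..t})" by (rule pigeonhole)
  then obtain i j i' j' where le: "i \<le> t" "j \<le> t" "i' \<le> t" "j' \<le> t" and ne: "i \<noteq> i' \<or> j \<noteq> j'"
    and eq: "[g ^ i * h ^ j = g ^ i' * h ^ j'] (mod int p)"
    unfolding inj_on_def Cong.cong_def by (simp add: split_paired_all) (metis atMost_iff)
  \<comment> \<open>Multiplying the two sides by x_g^(i+i') x_h^(j+j') turns g x_g into y_g and h
    x_h into y_h; every base is left with a single exponent at most \<open>t\<close>.\<close>
  let ?A = "y g ^ i * x g ^ i' * (y h ^ j * x h ^ j')" and ?B = "y g ^ i' * x g ^ i * (y h ^ j' * x h ^ j)"
  have "[?A = (g * x g) ^ i * x g ^ i' * ((h * x h) ^ j * x h ^ j')] (mod int p)"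
    by (intro cong_mult cong_pow cong_refl cong g h)
  also have "(g * x g) ^ i * x g ^ i' * ((h * x h) ^ j * x h ^ j')
      = (g ^ i * h ^ j) * (x g ^ i * x g ^ i' * (x h ^ j * x h ^ j'))"
    by (simp add: power_mult_distrib mult_ac)
  also have "[\<dots> = (g ^ i' * h ^ j') * (x g ^ i * x g ^ i' * (x h ^ j * x h ^ j'))] (mod int p)"
    by (intro cong_mult eq cong_refl)
  also have "(g ^ i' * h ^ j') * (x g ^ i * x g ^ i' * (x h ^ j * x h ^ j'))
      = (g * x g) ^ i' * x g ^ i * ((h * x h) ^ j' * x h ^ j)"
    by (simp add: power_mult_distrib mult_ac)
  also have "[\<dots> = ?B] (mod int p)"
    by (intro cong_mult cong_pow cong_refl cong_sym[OF cong] g h)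
  finally have "int p dvd ?A - ?B" by (simp add: cong_iff_dvd_diff)
  moreover have "\<bar>?A - ?B\<bar> < int p"
    using small_monomial[OF g h le(1,3,2,4)] small_monomial[OF g h le(3,1,4,2)] by linarith
  ultimately have "?A = ?B" using dvd_imp_le_int[of "?A - ?B" "int p"] by (cases "?A = ?B") auto
  thus ?thesis using that ne by blast
qed

text \<open>The logarithm of |y/x|, which makes multiplicative relations linear. It forgets the sign
  of y, but on \<open>S\<close> it still determines h.\<close>

definition height_log :: "int \<Rightarrow> real" where
  "height_log h = ln \<bar>real_of_int (y h)\<bar> - ln (real_of_int (x h))"

text \<open>Equal logarithms mean y_g/x_g = \<plusminus> y_h/x_h, hence g = \<plusminus> h modulo p,
  and the minus sign is impossible for odd d.\<close>

lemma height_log_eq_iff: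
  assumes "g \<in> S" "h \<in> S"
  shows "height_log g = height_log h \<longleftrightarrow> g = h"
proof
  assume eq: "height_log g = height_log h"
  have "ln \<bar>real_of_int (y g)\<bar> + ln (real_of_int (x h)) = ln \<bar>real_of_int (y h)\<bar> + ln (real_of_int (x g))"
    using eq by (simp add: height_log_def)
  hence "ln (\<bar>real_of_int (y g)\<bar> * real_of_int (x h)) = ln (\<bar>real_of_int (y h)\<bar> * real_of_int (x g))"
    using x[OF assms(1)] x[OF assms(2)] y[OF assms(1)] y[OF assms(2)] by (simp add: ln_mult)
  hence "\<bar>real_of_int (y g)\<bar> * real_of_int (x h) = \<bar>real_of_int (y h)\<bar> * real_of_int (x g)"
    using x[OF assms(1)] x[OF assms(2)] y[OF assms(1)] y[OF assms(2)]
    by (subst (asm) ln_inj_iff) auto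
  hence "real_of_int (\<bar>y g\<bar> * x h) = real_of_int (\<bar>y h\<bar> * x g)" by simp
  hence "\<bar>y g\<bar> * x h = \<bar>y h\<bar> * x g" by (simp only: of_int_eq_iff)
  hence "\<bar>y g * x h\<bar> = \<bar>y h * x g\<bar>" using x[OF assms(1)] x[OF assms(2)] by (simp add: abs_mult)
  hence cases: "y g * x h = y h * x g \<or> y g * x h = - y h * x g" by (auto simp: abs_eq_iff)
  have x_unit: "\<not> int p dvd x k" if "k \<in> S" for k
  proof
    assume "int p dvd x k"
    hence "int p dvd y k" using cong[OF that] by (metis cong_dvd_iff dvd_mult)
    hence "is_unit (int p)" using coprime_common_divisor[OF coprime[OF that] \<open>int p dvd x k\<close>] by simp
    thus False using p by auto
  qed
  have copr: "coprime (x g * x h) (int p)"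
    using x_unit assms p(1) by (metis coprime_commute coprime_mult_left_iff prime_imp_coprime prime_nat_int_transfer)
  have g': "[y g * x h = g * (x g * x h)] (mod int p)" and h': "[y h * x g = h * (x g * x h)] (mod int p)"
    using cong_mult[OF cong[OF assms(1)] cong_refl[of "x h"]] cong_mult[OF cong[OF assms(2)] cong_refl[of "x g"]]
    by (simp_all add: mult_ac)
  have "[g = h] (mod int p) \<or> [g = - h] (mod int p)"
  proof (rule disj_forward[OF cases])
    assume "y g * x h = y h * x g"
    hence "[g * (x g * x h) = h * (x g * x h)] (mod int p)" using g' h' by (metis cong_sym cong_trans)
    thus "[g = h] (mod int p)" using copr by (simp add: cong_mult_rcancel)
  next
    assume "y g * x h = - y h * x g"
    moreover have "[- (y h * x g) = - (h * (x g * x h))] (mod int p)" using h' by (simp add: cong_minus_minus_iff)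
    ultimately have "[g * (x g * x h) = - h * (x g * x h)] (mod int p)"
      using g' by (metis cong_sym cong_trans mult_minus_left)
    thus "[g = - h] (mod int p)" using copr by (simp only: cong_mult_rcancel)
  qed
  hence "[g = h] (mod int p)" using cong_minus_unity_roots_mod[OF p d] S assms by blast
  thus "g = h" using S assms by (intro cong_less_imp_eq_int) (auto simp: unity_roots_mod_def subset_iff)
qed simp

text \<open>Logarithm zero means |y| = x, so x = 1 by coprimality and h = \<plusminus> 1 modulo p; 1
  is excluded from \<open>S\<close> and -1 is no d-th root of unity.\<close>

lemma height_log_nonzero:
  assumes "h \<in> S"
  shows "height_log h \<noteq> 0"
proof
  assume "height_log h = 0"
  hence "\<bar>real_of_int (y h)\<bar> = real_of_int (x h)" using x y assms by (simp add: height_log_def)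
  hence abs: "\<bar>y h\<bar> = x h" by linarith
  have "x h dvd y h" using abs by (metis abs_dvd_iff dvd_abs_iff dvd_refl)
  hence "is_unit (x h)" using coprime[OF assms] by (simp add: coprime_absorb_left)
  hence "x h = 1" using x[OF assms] by auto
  hence "[h = 1] (mod int p) \<or> [h = -1] (mod int p)" using cong[OF assms] abs by (auto simp: abs_if cong_sym_eq split: if_splits)
  have "1 \<in> unity_roots_mod p d" using prime_gt_1_nat[OF p(1)] by (simp add: unity_roots_mod_def)
  with \<open>_ \<or> _\<close> have "[h = 1] (mod int p)" using cong_minus_unity_roots_mod[OF p d] S assms by blast
  hence "h = 1" using S assms prime_gt_1_nat[OF p(1)]
    by (intro cong_less_imp_eq_int) (auto simp: unity_roots_mod_def subset_iff)
  thus False using S assms by auto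
qed

text \<open>The map is the q-adic valuation of y/x, for a prime q occurring in one fixed fraction.
  By multiplicative dependence it satisfies the same linear relations as \<open>height_log\<close>,
  and so inherits injectivity and non-vanishing from it.\<close>

lemma exists_exponent:
  "\<exists>v :: int \<Rightarrow> int. inj_on v S \<and> (\<forall>h\<in>S. v h \<noteq> 0 \<and> 2 ^ nat \<bar>v h\<bar> \<le> x h * \<bar>y h\<bar>)"
proof (cases "S = {}")
  case False
  then obtain h0 where h0: "h0 \<in> S" by auto
  \<comment> \<open>A prime q exists because the fraction of h0 is not \<plusminus> 1; by
    coprimality q divides only one of its entries, so v h0 is nonzero.\<close>
  have "\<not> is_unit (x h0 * y h0)"
  proof
    assume "is_unit (x h0 * y h0)"
    hence "\<bar>x h0\<bar> = 1" "\<bar>y h0\<bar> = 1" by (auto simp: abs_zmult_eq_1 mult.commute dest: abs_zmult_eq_1)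
    hence "height_log h0 = 0" using x[OF h0] by (simp add: height_log_def flip: of_int_abs)
    thus False using height_log_nonzero[OF h0] by simp
  qed
  moreover have "x h0 * y h0 \<noteq> 0" using x y h0 by fastforce
  ultimately obtain q where q: "Factorial_Ring.prime q" "q dvd x h0 * y h0" using prime_divisor_exists by blast
  have qe: "prime_elem q" using q(1) by (rule prime_imp_prime_elem)
  define v where "v = (\<lambda>h. int (multiplicity q (y h)) - int (multiplicity q (x h)))"
  have nz: "x h \<noteq> 0" "y h \<noteq> 0" if "h \<in> S" for h using x y that by fastforce+
  have v0: "v h0 \<noteq> 0"
  proof -
    have "\<not> (q dvd x h0 \<and> q dvd y h0)"
      using coprime[OF h0] q(1) by (auto simp: coprime_def)
    moreover have "q dvd x h0 \<or> q dvd y h0" using q by (simp add: prime_dvd_mult_iff)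
    ultimately show ?thesis using nz[OF h0] q(1)
      unfolding v_def by (auto simp: not_dvd_imp_multiplicity_0 multiplicity_eq_zero_iff)
  qed
  \<comment> \<open>Valuation and logarithm are both additive, so the exponents i - i' and j - j' of
    the relation in \<open>dependent\<close> serve both at once.\<close>
  have rel: "\<exists>a b :: int. (a \<noteq> 0 \<or> b \<noteq> 0) \<and> a * v g + b * v h = 0 \<and> a * height_log g + b * height_log h = 0"
    if g: "g \<in> S" and h: "h \<in> S" for g h
  proof -
    obtain i i' j j' where ne: "i \<noteq> i' \<or> j \<noteq> j'"
      and eq: "y g ^ i * x g ^ i' * (y h ^ j * x h ^ j') = y g ^ i' * x g ^ i * (y h ^ j' * x h ^ j)"
      using dependent[OF g h] by blast
    have "multiplicity q (y g ^ i * x g ^ i' * (y h ^ j * x h ^ j'))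
        = i * multiplicity q (y g) + i' * multiplicity q (x g) + (j * multiplicity q (y h) + j' * multiplicity q (x h))" for i i' j j'
      using nz[OF g] nz[OF h] qe by (simp add: prime_elem_multiplicity_mult_distrib prime_elem_multiplicity_power_distrib)
    from this[of i i' j j'] this[of i' i j' j] eq
    have "int (i * multiplicity q (y g) + i' * multiplicity q (x g) + (j * multiplicity q (y h) + j' * multiplicity q (x h)))
       = int (i' * multiplicity q (y g) + i * multiplicity q (x g) + (j' * multiplicity q (y h) + j * multiplicity q (x h)))"
      by simp
    hence 1: "(int i - int i') * v g + (int j - int j') * v h = 0"
      unfolding v_def by (simp add: algebra_simps)
    have "ln \<bar>real_of_int (y g ^ i * x g ^ i' * (y h ^ j * x h ^ j'))\<bar>
        = i * ln \<bar>real_of_int (y g)\<bar> + i' * ln (x g) + (j * ln \<bar>real_of_int (y h)\<bar> + j' * ln (x h))" for i i' j j'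
      using nz[OF g] nz[OF h] x[OF g] x[OF h] by (simp add: abs_mult power_abs ln_mult ln_realpow)
    from this[of i i' j j'] this[of i' i j' j] eq
    have "i * ln \<bar>real_of_int (y g)\<bar> + i' * ln (x g) + (j * ln \<bar>real_of_int (y h)\<bar> + j' * ln (x h))
        = i' * ln \<bar>real_of_int (y g)\<bar> + i * ln (x g) + (j' * ln \<bar>real_of_int (y h)\<bar> + j * ln (x h))"
      by simp
    hence "(int i - int i') * height_log g + (int j - int j') * height_log h = 0"
      unfolding height_log_def by (simp add: algebra_simps)
    with 1 ne show ?thesis by (intro exI[of _ "int i - int i'"] exI[of _ "int j - int j'"]) auto
  qed
  \<comment> \<open>If v h = 0, the relation with h0 has b = 0 since v h0 is nonzero; then a is
    nonzero and \<open>height_log\<close> h would vanish.\<close>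
  have vnz: "v h \<noteq> 0" if h: "h \<in> S" for h
  proof
    assume "v h = 0"
    then obtain a b :: int where "a \<noteq> 0 \<or> b \<noteq> 0" "b * v h0 = 0" "a * height_log h + b * height_log h0 = 0"
      using rel[OF h h0] by auto
    thus False using v0 height_log_nonzero[OF h] by auto
  qed
  \<comment> \<open>Equal nonzero valuations force b = -a in the relation, so the logarithms agree
    as well.\<close>
  have "inj_on v S"
  proof (rule inj_onI)
    fix g h assume g: "g \<in> S" and h: "h \<in> S" and eq: "v g = v h"
    obtain a b :: int where ab: "a \<noteq> 0 \<or> b \<noteq> 0" "a * v g + b * v h = 0" "a * height_log g + b * height_log h = 0"
      using rel[OF g h] by auto
    have "(a + b) * v h = 0" using ab(2) eq by (simp add: algebra_simps)
    hence "b = - a" using vnz[OF h] by simp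
    hence "real_of_int a * (height_log g - height_log h) = 0" "a \<noteq> 0" using ab by (simp_all add: algebra_simps)
    thus "g = h" using height_log_eq_iff[OF g h] by simp
  qed
  moreover have "2 ^ nat \<bar>v h\<bar> \<le> x h * \<bar>y h\<bar>" if h: "h \<in> S" for h
  proof -
    define k where "k = nat \<bar>v h\<bar>"
    have "k \<le> multiplicity q (y h) \<or> k \<le> multiplicity q (x h)" unfolding k_def v_def by linarith
    hence "q ^ k dvd y h \<or> q ^ k dvd x h" using multiplicity_dvd' by blast
    hence "q ^ k dvd x h * y h" by auto
    hence "q ^ k \<le> \<bar>x h * y h\<bar>" using nz[OF h] by (intro zdvd_imp_le) auto
    moreover have "2 ^ k \<le> q ^ k" using prime_ge_2_int[OF q(1)] by (intro power_mono) auto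
    ultimately show ?thesis using x[OF h] by (simp add: abs_mult k_def)
  qed
  ultimately show ?thesis using vnz by blast
qed simp

end

text \<open>An injective integer map takes each absolute value at most twice; splitting by sign
  leaves two partial sums of one geometric series.\<close>

lemma sum_powr_inj_le:
  fixes w :: real and v :: "'a \<Rightarrow> int"
  assumes w: "0 < w" "w < 1" and inj: "inj_on v S" and fin: "finite S"
  shows "(\<Sum>h\<in>S. w ^ nat \<bar>v h\<bar>) \<le> 2 / (1 - w)"
proof -
  have half: "(\<Sum>h\<in>A. w ^ nat \<bar>v h\<bar>) \<le> 1 / (1 - w)" if "A \<subseteq> S" "inj_on (\<lambda>h. nat \<bar>v h\<bar>) A" for A
  proof -
    have "(\<Sum>h\<in>A. w ^ nat \<bar>v h\<bar>) = (\<Sum>k\<in>(\<lambda>h. nat \<bar>v h\<bar>) ` A. w ^ k)"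
      using that(2) by (simp add: sum.reindex)
    also have "\<dots> \<le> (\<Sum>k. w ^ k)"
      using w that(1) fin finite_subset by (intro sum_le_suminf summable_geometric) auto
    also have "\<dots> = 1 / (1 - w)" using w by (simp add: suminf_geometric)
    finally show ?thesis .
  qed
  have "(\<Sum>h\<in>S. w ^ nat \<bar>v h\<bar>) = (\<Sum>h\<in>{h\<in>S. v h \<ge> 0}. w ^ nat \<bar>v h\<bar>) + (\<Sum>h\<in>{h\<in>S. \<not> v h \<ge> 0}. w ^ nat \<bar>v h\<bar>)"
    using fin by (subst sum.union_disjoint[symmetric]) (auto intro!: sum.cong)
  also have "\<dots> \<le> 1 / (1 - w) + 1 / (1 - w)"
    using inj by (intro add_mono half) (auto simp: inj_on_def)
  finally show ?thesis by simp
qed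

section \<open>The contribution of a single residue\<close>

text \<open>The residue of least absolute value, strictly between -p/2 and p/2 for odd p.\<close>

definition symres :: "nat \<Rightarrow> int \<Rightarrow> int" where
  "symres p n = (if 2 * (n mod int p) < int p then n mod int p else n mod int p - int p)"

lemma cong_symres: "[symres p n = n] (mod int p)"
  by (simp add: symres_def Cong.cong_def)

lemma abs_symres_le:
  assumes "odd p"
  shows "2 * \<bar>symres p n\<bar> \<le> int p - 1"
proof -
  have "p > 0" using assms by (auto intro: Nat.gr0I)
  define r where "r = n mod int p"
  have r: "0 \<le> r" "r < int p" using \<open>p > 0\<close> by (simp_all add: r_def)
  obtain k where k: "int p = 2 * k + 1" using assms by (metis oddE even_of_nat)
  show ?thesis
  proof (cases "2 * r < int p")
    case True
    hence "symres p n = r" by (simp add: symres_def r_def)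
    thus ?thesis using True r k by linarith
  next
    case False
    hence "symres p n = r - int p" by (simp add: symres_def r_def)
    moreover have "k + 1 \<le> r" using False k by presburger
    ultimately show ?thesis using r k by linarith
  qed
qed

lemma abs_symres_eq_imp_cong:
  assumes "\<bar>symres p m\<bar> = \<bar>symres p n\<bar>"
  shows "[m = n] (mod int p) \<or> [m = - n] (mod int p)"
proof -
  have "symres p m = symres p n \<or> symres p m = - symres p n" using assms by (auto simp: abs_eq_iff)
  moreover have "[- symres p n = - n] (mod int p)" using cong_symres by (simp add: cong_minus_minus_iff)
  ultimately show ?thesis using cong_symres by (metis cong_sym cong_trans)
qed

text \<open>Thue's argument: with s the integer part of sqrt p there are more than p pairs with
  entries from 0 to s, so two of them agree under (u, v) \<mapsto> h u - v. Their difference, made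
  coprime and normalised in sign, is the required pair.\<close>

lemma Thue_coprime:
  assumes p: "Factorial_Ring.prime p" and h: "\<not> int p dvd h"
  obtains x y :: int where "0 < x" "y \<noteq> 0" "coprime x y" "x\<^sup>2 \<le> int p" "y\<^sup>2 \<le> int p" "[y = h * x] (mod int p)"
proof -
  have p': "Factorial_Ring.prime (int p)" and p1: "p > 1" using p prime_gt_1_nat[OF p] by simp_all
  define s where "s = floor_sqrt p"
  have s: "s\<^sup>2 \<le> p" "p < (s + 1)\<^sup>2" using Suc_floor_sqrt_power2_gt[of p] by (auto simp: s_def)
  have "s < p"
  proof (rule ccontr)
    assume "\<not> s < p"
    hence "p * p \<le> s\<^sup>2" unfolding power2_eq_square by (intro mult_le_mono) auto
    hence "p * p \<le> p" using s by linarith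
    thus False using p1 by simp
  qed
  let ?f = "\<lambda>(u, v). (h * u - v) mod int p"
  have "card (?f ` ({0..int s} \<times> {0..int s})) \<le> card {0..<int p}"
    using p1 by (intro card_mono) auto
  also have "\<dots> < card ({0..int s} \<times> {0..int s})"
    using s(2) by (simp add: card_cartesian_product power2_eq_square nat_add_distrib)
  finally have "\<not> inj_on ?f ({0..int s} \<times> {0..int s})" by (rule pigeonhole)
  then obtain u v u' v' where uv: "u \<in> {0..int s}" "v \<in> {0..int s}" "u' \<in> {0..int s}" "v' \<in> {0..int s}"
    "u \<noteq> u' \<or> v \<noteq> v'" "[h * u - v = h * u' - v'] (mod int p)"
    unfolding inj_on_def Cong.cong_def by (simp add: split_paired_all) (metis atLeastAtMost_iff)
  define a b where "a = u - u'" and "b = v - v'"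
  have ab: "int p dvd h * a - b" using uv(6) by (simp add: cong_iff_dvd_diff a_def b_def algebra_simps)
  have abs: "\<bar>a\<bar> \<le> int s" "\<bar>b\<bar> \<le> int s" using uv by (auto simp: a_def b_def)
  have small: "z = 0" if "int p dvd z" "\<bar>z\<bar> \<le> int s" for z
    using that \<open>s < p\<close> dvd_imp_le_int[of z "int p"] by force
  have "a \<noteq> 0"
  proof
    assume "a = 0"
    hence "b = 0" using small ab abs by simp
    thus False using \<open>a = 0\<close> uv(5) by (simp add: a_def b_def)
  qed
  have "b \<noteq> 0"
  proof
    assume "b = 0"
    hence "int p dvd a" using ab p' h by (simp add: prime_dvd_mult_iff)
    thus False using small abs \<open>a \<noteq> 0\<close> by blast
  qed
  define g where "g = gcd a b"
  have g: "g > 0" "g dvd a" "g dvd b" using \<open>a \<noteq> 0\<close> by (auto simp: g_def)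
  \<comment> \<open>Dividing by the gcd gives coprimality and the factor \<open>sgn a\<close> makes
    x positive. The congruence survives because 0 < g <= |a| < p, so p does not divide g.\<close>
  define x y where "x = sgn a * (a div g)" and "y = sgn a * (b div g)"
  have gx: "g * x = sgn a * a" and gy: "g * y = sgn a * b" using g by (simp_all add: x_def y_def)
  have "coprime (a div g) (b div g)" unfolding g_def using \<open>a \<noteq> 0\<close> by (intro div_gcd_coprime) auto
  hence "coprime x y" using \<open>a \<noteq> 0\<close> by (simp add: x_def y_def sgn_if)
  moreover have "x > 0"
  proof -
    have "g * x > 0" unfolding gx using \<open>a \<noteq> 0\<close> by (simp add: sgn_if)
    thus ?thesis using g(1) by (simp add: zero_less_mult_iff)
  qed
  moreover have "y \<noteq> 0" using gy \<open>b \<noteq> 0\<close> \<open>a \<noteq> 0\<close> by (auto simp: sgn_eq_0_iff)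
  moreover have "[y = h * x] (mod int p)"
  proof -
    have "g * (h * x - y) = sgn a * (h * a - b)" using gx gy by (simp add: algebra_simps)
    hence "int p dvd g * (h * x - y)" using ab by simp
    moreover have "g \<le> \<bar>a\<bar>" using g \<open>a \<noteq> 0\<close> by (intro zdvd_imp_le) auto
    hence "\<not> int p dvd g" using small[of g] g(1) abs by auto
    ultimately have "int p dvd h * x - y" using p' by (simp add: prime_dvd_mult_iff)
    thus ?thesis by (simp add: cong_iff_dvd_diff dvd_diff_commute)
  qed
  moreover have le: "z\<^sup>2 \<le> int p" if "\<bar>g * z\<bar> \<le> int s" for z
  proof -
    have "1 * \<bar>z\<bar> \<le> g * \<bar>z\<bar>" using g(1) by (intro mult_right_mono) auto
    hence "\<bar>z\<bar> \<le> int s" using that g(1) by (simp add: abs_mult)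
    hence "\<bar>z\<bar>\<^sup>2 \<le> (int s)\<^sup>2" by (intro power_mono) auto
    also have "\<dots> \<le> int p" using s(1) by (metis of_nat_le_iff of_nat_power)
    finally show ?thesis by simp
  qed
  moreover have "\<bar>g * x\<bar> \<le> int s" "\<bar>g * y\<bar> \<le> int s" using abs \<open>a \<noteq> 0\<close> by (simp_all add: gx gy abs_mult)
  ultimately show ?thesis using that by blast
qed

section \<open>Harmonic and inverse-square sums over least residues\<close>

lemma harmonic_le_ln: "n > 0 \<Longrightarrow> (\<Sum>k=1..n. 1 / real k) \<le> 1 + ln (real n)"
proof (induction n rule: nat_induct_non_zero)
  case (Suc n)
  have "ln (real n / real (Suc n)) \<le> real n / real (Suc n) - 1" using Suc by (intro ln_le_minus_one) auto
  also have "\<dots> = - (1 / real (Suc n))" by (simp add: field_simps)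
  finally have "ln (real n) + 1 / real (Suc n) \<le> ln (real (Suc n))" using Suc by (simp add: ln_div)
  with Suc.IH show ?case by simp
qed simp

lemma sum_inverse_int_eq: "(\<Sum>k\<in>{1..int n}. 1 / real_of_int k) = (\<Sum>k=1..n. 1 / real k)"
  by (rule sum.reindex_bij_witness[of _ int nat]) auto

lemma sum_inverse_squares_le: "(\<Sum>k\<in>{1..int n}. 1 / (real_of_int k)\<^sup>2) \<le> 3"
proof -
  have "(\<Sum>k\<in>{1..int n}. 1 / (real_of_int k)\<^sup>2) = (\<Sum>k<n. 1 / (real k + 1)\<^sup>2)"
    by (rule sum.reindex_bij_witness[of _ "\<lambda>k. int k + 1" "\<lambda>k. nat (k - 1)"]) auto
  also have "\<dots> \<le> pi\<^sup>2 / 6"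
    using inverse_squares_sums sum_le_suminf[OF sums_summable[OF inverse_squares_sums], of "{..<n}"]
    by (simp add: sums_iff add.commute)
  also have "\<dots> \<le> 4\<^sup>2 / 6" using pi_less_4 by (intro divide_right_mono power_mono) auto
  finally show ?thesis by simp
qed

text \<open>The k for which z/k equals the rational y/x (z the least residue of h k) give the main
  contribution. For every other k the pair (k, z) is far from the origin: k + |z| >= sqrt p.\<close>

lemma sum_inverse_symres_le:
  assumes p: "Factorial_Ring.prime p" "odd p" and h: "\<not> int p dvd h"
    and xy: "0 < x" "y \<noteq> 0" "coprime x y" "x\<^sup>2 \<le> int p" "y\<^sup>2 \<le> int p" "[y = h * x] (mod int p)"
  shows "(\<Sum>k\<in>{1..(int p - 1) div 2}. 1 / (real_of_int k * \<bar>symres p (h * k)\<bar>))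
           \<le> 3 / (x * \<bar>y\<bar>) + 2 * (1 + ln p) / sqrt p"
proof -
  have p': "Factorial_Ring.prime (int p)" and p1: "p > 1" using p prime_gt_1_nat[OF p(1)] by simp_all
  have "p \<ge> 3" using p p1 by (cases "p = 2") auto
  define n where "n = (p - 1) div 2"
  have n: "int n = (int p - 1) div 2" "n > 0" "n \<le> p" using p1 \<open>p \<ge> 3\<close> by (auto simp: n_def zdiv_int of_nat_diff)
  have n2: "2 * int n = int p - 1" unfolding n(1) using p by simp
  let ?z = "\<lambda>k. symres p (h * k)"
  have unit: "\<not> int p dvd k" if "k \<in> {1..int n}" for k
    using that zdvd_imp_le[of "int p" k] n2 by auto
  have z0: "?z k \<noteq> 0" if "k \<in> {1..int n}" for k
  proof
    assume "?z k = 0"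
    hence "int p dvd h * k" using cong_symres[of p "h * k"] by (metis cong_0_iff cong_sym)
    thus False using p' h unit[OF that] by (simp add: prime_dvd_mult_iff)
  qed
  have z_le: "\<bar>?z k\<bar> \<in> {1..int n}" if "k \<in> {1..int n}" for k
    using z0[OF that] abs_symres_le[OF p(2), of "h * k"] n2 by auto
  \<comment> \<open>As in Gauss's lemma, k \<mapsto> |z| is injective on the half system 1, ..., (p
    - 1)/2 and maps it into itself.\<close>
  have z_inj: "inj_on (\<lambda>k. \<bar>?z k\<bar>) {1..int n}"
  proof (rule inj_onI)
    fix k l assume kl: "k \<in> {1..int n}" "l \<in> {1..int n}" "\<bar>?z k\<bar> = \<bar>?z l\<bar>"
    hence "[h * k = h * l] (mod int p) \<or> [h * k = - (h * l)] (mod int p)"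
      by (intro abs_symres_eq_imp_cong)
    hence "int p dvd h * (k - l) \<or> int p dvd h * (k + l)"
      by (simp add: cong_iff_dvd_diff algebra_simps)
    hence "int p dvd k - l \<or> int p dvd k + l" using p' h by (simp add: prime_dvd_mult_iff)
    moreover have "\<not> int p dvd k + l"
      using kl n2 zdvd_imp_le[of "int p" "k + l"] by auto
    moreover have "k = l" if "int p dvd k - l"
      using that kl n2 dvd_imp_le_int[of "k - l" "int p"] by (cases "k = l") auto
    ultimately show "k = l" by blast
  qed
  define A where "A = {k \<in> {1..int n}. k * y = ?z k * x}"
  define B where "B = {k \<in> {1..int n}. k * y \<noteq> ?z k * x}"
  have "(\<Sum>k\<in>{1..int n}. 1 / (real_of_int k * \<bar>?z k\<bar>))
      = (\<Sum>k\<in>A. 1 / (real_of_int k * \<bar>?z k\<bar>)) + (\<Sum>k\<in>B. 1 / (real_of_int k * \<bar>?z k\<bar>))"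
  proof -
    have "finite A" "finite B" unfolding A_def B_def by (rule finite_subset[of _ "{1..int n}"]; auto)+
    moreover have "A \<inter> B = {}" "{1..int n} = A \<union> B" unfolding A_def B_def by auto
    ultimately show ?thesis by (simp add: sum.union_disjoint)
  qed
  \<comment> \<open>By coprimality k = j x and z = j y here, so the term is 1/(j^2 x |y|) and the
    sum over j is at most 3.\<close>
  also have "(\<Sum>k\<in>A. 1 / (real_of_int k * \<bar>?z k\<bar>)) \<le> 3 / (x * \<bar>y\<bar>)"
  proof -
    have xk: "x dvd k" if "k \<in> A" for k
    proof -
      have "x dvd k * y" using that by (simp add: A_def)
      thus ?thesis using xy(3) coprime_dvd_mult_left_iff by blast
    qed
    have "(\<Sum>k\<in>A. 1 / (real_of_int k * \<bar>?z k\<bar>)) = (\<Sum>k\<in>A. 1 / (real_of_int (k div x))\<^sup>2 * (1 / (x * \<bar>y\<bar>)))"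
    proof (intro sum.cong refl)
      fix k assume k: "k \<in> A"
      obtain j where j: "k = x * j" using xk[OF k] by auto
      have "?z k = j * y" using k j xy(1) by (simp add: A_def)
      moreover have "0 < x * j" using k j by (simp add: A_def)
      hence "j > 0" using xy(1) by (simp add: zero_less_mult_iff)
      ultimately have "real_of_int k * \<bar>?z k\<bar> = (real_of_int j)\<^sup>2 * (x * \<bar>y\<bar>)"
        unfolding j by (simp add: abs_mult power2_eq_square)
      moreover have "k div x = j" using j xy(1) by simp
      ultimately show "1 / (real_of_int k * \<bar>?z k\<bar>) = 1 / (real_of_int (k div x))\<^sup>2 * (1 / (x * \<bar>y\<bar>))"
        by simp
    qed
    also have "\<dots> = (\<Sum>j\<in>(\<lambda>k. k div x) ` A. 1 / (real_of_int j)\<^sup>2) * (1 / (x * \<bar>y\<bar>))"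
    proof -
      have "inj_on (\<lambda>k. k div x) A"
      proof (rule inj_onI)
        fix k l assume kl: "k \<in> A" "l \<in> A" "k div x = l div x"
        have "k = x * (k div x)" using xk[OF kl(1)] by simp
        also have "\<dots> = l" using xk[OF kl(2)] kl(3) by simp
        finally show "k = l" .
      qed
      thus ?thesis by (subst sum.reindex) (simp_all only: sum_distrib_right o_def)
    qed
    also have "(\<Sum>j\<in>(\<lambda>k. k div x) ` A. 1 / (real_of_int j)\<^sup>2) \<le> (\<Sum>j\<in>{1..int n}. 1 / (real_of_int j)\<^sup>2)"
    proof (rule sum_mono2)
      show "(\<lambda>k. k div x) ` A \<subseteq> {1..int n}"
      proof
        fix j assume "j \<in> (\<lambda>k. k div x) ` A"
        then obtain k where k: "k \<in> A" "j = k div x" by auto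
        have "k = x * j" using xk[OF k(1)] k(2) by simp
        moreover have "k \<in> {1..int n}" using k by (simp add: A_def)
        ultimately have "0 < x * j" "x * j \<le> int n" by auto
        moreover have "j > 0" using \<open>0 < x * j\<close> xy(1) by (simp add: zero_less_mult_iff)
        moreover have "1 * j \<le> x * j" using xy(1) \<open>j > 0\<close> by (intro mult_right_mono) auto
        ultimately show "j \<in> {1..int n}" by (simp only: atLeastAtMost_iff) linarith
      qed
    qed auto
    also have "\<dots> \<le> 3" by (rule sum_inverse_squares_le)
    finally show ?thesis using xy(1) by (simp add: divide_right_mono)
  qed
  \<comment> \<open>Now k y - z x is a nonzero multiple of p, so p <= k|y| + |z|x <= (k + |z|) sqrt
    p. Since 1/k + 1/|z| = (k + |z|)/(k|z|), two harmonic sums divided by sqrt p remain.\<close>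
  also have "(\<Sum>k\<in>B. 1 / (real_of_int k * \<bar>?z k\<bar>)) \<le> (\<Sum>k\<in>B. (1 / real_of_int k + 1 / \<bar>?z k\<bar>) / sqrt p)"
  proof (rule sum_mono)
    fix k assume "k \<in> B"
    hence k: "k \<in> {1..int n}" "k * y \<noteq> ?z k * x" by (auto simp: B_def)
    have "[k * y - ?z k * x = k * (h * x) - h * k * x] (mod int p)"
      by (intro cong_diff cong_mult cong_refl xy cong_symres)
    hence "int p dvd k * y - ?z k * x" by (simp add: cong_0_iff mult_ac)
    hence "int p \<le> \<bar>k * y - ?z k * x\<bar>" using k(2) by (intro zdvd_imp_le) auto
    also have "\<dots> \<le> k * \<bar>y\<bar> + \<bar>?z k\<bar> * x"
      using k xy(1) abs_triangle_ineq4[of "k * y" "?z k * x"] by (simp add: abs_mult)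
    finally have "real_of_int (int p) \<le> real_of_int (k * \<bar>y\<bar> + \<bar>?z k\<bar> * x)" by linarith
    hence "real p \<le> k * \<bar>real_of_int y\<bar> + \<bar>real_of_int (?z k)\<bar> * x" by simp
    also have "\<dots> \<le> k * sqrt p + \<bar>real_of_int (?z k)\<bar> * sqrt p"
    proof (intro add_mono mult_left_mono)
      have "real_of_int (y\<^sup>2) \<le> real_of_int (int p)" "real_of_int (x\<^sup>2) \<le> real_of_int (int p)" using xy by linarith+
      thus "\<bar>real_of_int y\<bar> \<le> sqrt p" "real_of_int x \<le> sqrt p" by (auto intro!: real_le_rsqrt)
    qed (use k in auto)
    finally have "sqrt p * sqrt p \<le> (k + \<bar>real_of_int (?z k)\<bar>) * sqrt p" by (simp add: algebra_simps)
    hence le: "sqrt p \<le> k + \<bar>real_of_int (?z k)\<bar>"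
      by (rule mult_right_le_imp_le) (use p1 in simp)
    have pos: "real_of_int k > 0" "\<bar>real_of_int (?z k)\<bar> > 0" using k z0[OF k(1)] by auto
    have "1 / (real_of_int k * \<bar>?z k\<bar>) * sqrt p
        \<le> 1 / (real_of_int k * \<bar>?z k\<bar>) * (k + \<bar>real_of_int (?z k)\<bar>)"
      using pos le by (intro mult_left_mono) auto
    also have "\<dots> = 1 / real_of_int k + 1 / \<bar>?z k\<bar>" using pos by (simp add: field_simps)
    finally show "1 / (real_of_int k * \<bar>?z k\<bar>) \<le> (1 / real_of_int k + 1 / \<bar>?z k\<bar>) / sqrt p"
      using p1 by (simp add: pos_le_divide_eq)
  qed
  also have "\<dots> \<le> (\<Sum>k\<in>{1..int n}. (1 / real_of_int k + 1 / \<bar>?z k\<bar>) / sqrt p)"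
    by (rule sum_mono2) (auto simp: B_def)
  also have "\<dots> = ((\<Sum>k\<in>{1..int n}. 1 / real_of_int k) + (\<Sum>k\<in>{1..int n}. 1 / real_of_int \<bar>?z k\<bar>)) / sqrt p"
    by (simp add: sum_divide_distrib sum.distrib add_divide_distrib)
  also have "(\<Sum>k\<in>{1..int n}. 1 / real_of_int \<bar>?z k\<bar>) = (\<Sum>j\<in>(\<lambda>k. \<bar>?z k\<bar>) ` {1..int n}. 1 / real_of_int j)"
    using z_inj by (simp add: sum.reindex)
  also have "\<dots> \<le> (\<Sum>j\<in>{1..int n}. 1 / real_of_int j)"
    using z_le by (intro sum_mono2) auto
  also have "(\<Sum>j\<in>{1..int n}. 1 / real_of_int j) \<le> 1 + ln p"
  proof -
    have "(\<Sum>j\<in>{1..int n}. 1 / real_of_int j) \<le> 1 + ln n"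
      unfolding sum_inverse_int_eq by (rule harmonic_le_ln[OF n(2)])
    also have "ln (real n) \<le> ln (real p)" using n by simp
    finally show ?thesis by simp
  qed
  finally show ?thesis unfolding n(1) by (simp add: divide_right_mono algebra_simps)
qed

section \<open>Cotangent sums\<close>

text \<open>The partial fraction expansion of the cotangent, from the logarithmic derivative of the
  reflection formula for Gamma: pi cot(pi z) = Digamma(1 - z) - Digamma(z).\<close>

lemma sums_cot:
  fixes z :: real
  assumes z: "0 < z" "z < 1"
  shows "(\<lambda>n. 1 / (real n + z) - 1 / (real n + 1 - z)) sums (pi * cot (pi * z))"
proof -
  have refl: "Gamma w * Gamma (1 - w) * sin (pi * w) = pi" if "w \<in> {0<..<1}" for w :: real
  proof -
    have s: "sin (pi * w) > 0" using that by (intro sin_gt_zero) auto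
    have "complex_of_real (Gamma w * Gamma (1 - w)) = of_real (pi / sin (pi * w))"
    proof -
      have "complex_of_real (Gamma w * Gamma (1 - w)) = Gamma (of_real w) * Gamma (of_real (1 - w))"
        by (simp only: Gamma_complex_of_real of_real_mult)
      also have "\<dots> = of_real (pi / sin (pi * w))"
        using Gamma_reflection_complex[of "of_real w"] by (simp add: sin_of_real[symmetric])
      finally show ?thesis .
    qed
    hence "Gamma w * Gamma (1 - w) = pi / sin (pi * w)" by (simp only: of_real_eq_iff)
    thus ?thesis using s by simp
  qed
  have ni: "z \<notin> \<int>\<^sub>\<le>\<^sub>0" "1 - z \<notin> \<int>\<^sub>\<le>\<^sub>0" using z by (auto elim!: nonpos_Ints_cases)
  define G where "G = Gamma z * Gamma (1 - z)"
  have "((\<lambda>w. Gamma w * Gamma (1 - w) * sin (pi * w)) has_field_derivative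
     G * ((Digamma z - Digamma (1 - z)) * sin (pi * z) + pi * cos (pi * z))) (at z)"
    unfolding G_def using ni
    by (auto intro!: derivative_eq_intros simp: algebra_simps)
  \<comment> \<open>By reflection the function is constantly pi on (0, 1); comparing the two
    derivatives gives the Digamma identity.\<close>
  moreover have "((\<lambda>w. Gamma w * Gamma (1 - w) * sin (pi * w)) has_field_derivative 0) (at z)"
    by (rule has_field_derivative_transform_within_open[of "\<lambda>_. pi" _ _ "{0<..<1}"])
       (use z refl in auto)
  ultimately have "G * ((Digamma z - Digamma (1 - z)) * sin (pi * z) + pi * cos (pi * z)) = 0"
    by (rule DERIV_unique)
  moreover have "G \<noteq> 0" using refl[of z] z unfolding G_def by auto
  moreover have "sin (pi * z) > 0" using z by (intro sin_gt_zero) auto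
  ultimately have "(Digamma z - Digamma (1 - z)) * sin (pi * z) + pi * cos (pi * z) = 0" "sin (pi * z) \<noteq> 0"
    by auto
  hence cot: "pi * cot (pi * z) = Digamma (1 - z) - Digamma z"
    by (simp add: cot_def field_simps)
  have D: "(\<lambda>k. inverse (real (Suc k)) - inverse (w + real k)) sums (Digamma w + euler_mascheroni)"
    if "w \<noteq> 0" for w :: real
    using summable_sums[OF summable_Digamma[OF that]] by (simp add: Digamma_def)
  have "1 - z \<noteq> 0" "z \<noteq> 0" using z by auto
  from sums_diff[OF D[OF this(1)] D[OF this(2)]] show ?thesis
    unfolding cot by (simp add: inverse_eq_divide algebra_simps)
qed

text \<open>A partial sum differs from a sum of complete blocks by fewer than p terms, all tending
  to 0. The detour is needed because the series for L(1,\<chi>) converges only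
  conditionally.\<close>

lemma sums_from_blocks:
  fixes a :: "nat \<Rightarrow> 'a :: real_normed_vector"
  assumes p: "p > 0" and blocks: "(\<lambda>q. \<Sum>j<p. a (q * p + j)) sums S" and a: "a \<longlonglongrightarrow> 0"
  shows "a sums S"
proof -
  have sum_blocks: "(\<Sum>n<q * p. a n) = (\<Sum>q'<q. \<Sum>j<p. a (q' * p + j))" for q
  proof (induction q)
    case (Suc q)
    have "(\<Sum>n<Suc q * p. a n) = (\<Sum>n<q * p. a n) + (\<Sum>n\<in>{q * p..<q * p + p}. a n)"
      by (subst sum.union_disjoint[symmetric]) (auto intro!: sum.cong)
    also have "(\<Sum>n\<in>{q * p..<q * p + p}. a n) = (\<Sum>j<p. a (q * p + j))"
      using sum.shift_bounds_nat_ivl[of a 0 "q * p" p] by (simp add: add_ac lessThan_atLeast0)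
    finally show ?case using Suc by simp
  qed simp
  have div: "filterlim (\<lambda>M. M div p) at_top sequentially"
    using p by (rule filterlim_at_top_div_const_nat)
  have "(\<lambda>M. (\<Sum>q<M div p. \<Sum>j<p. a (q * p + j)) + (\<Sum>j<M mod p. a (M div p * p + j))) \<longlonglongrightarrow> S + 0"
  proof (rule tendsto_add)
    show "(\<lambda>M. \<Sum>q<M div p. \<Sum>j<p. a (q * p + j)) \<longlonglongrightarrow> S"
      using filterlim_compose[OF blocks[unfolded sums_def] div] .
    have "(\<lambda>M. \<Sum>j<p. norm (a (M div p * p + j))) \<longlonglongrightarrow> 0"
    proof (rule tendsto_null_sum)
      fix j
      have "filterlim (\<lambda>M. M div p * p + j) at_top sequentially"
        by (rule filterlim_at_top_mono[OF div]) (use p in \<open>auto intro!: always_eventually trans_le_add1\<close>)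
      thus "(\<lambda>M. norm (a (M div p * p + j))) \<longlonglongrightarrow> 0"
        using tendsto_norm_zero[OF filterlim_compose[OF a]] by blast
    qed
    thus "(\<lambda>M. \<Sum>j<M mod p. a (M div p * p + j)) \<longlonglongrightarrow> 0"
    proof (rule Lim_null_comparison[rotated], intro always_eventually allI)
      fix M
      have "norm (\<Sum>j<M mod p. a (M div p * p + j)) \<le> (\<Sum>j<M mod p. norm (a (M div p * p + j)))"
        by (rule norm_sum)
      also have "\<dots> \<le> (\<Sum>j<p. norm (a (M div p * p + j)))"
        using p by (intro sum_mono2) (auto intro: less_trans)
      finally show "norm (\<Sum>j<M mod p. a (M div p * p + j)) \<le> (\<Sum>j<p. norm (a (M div p * p + j)))" .
    qed
  qed
  moreover have "(\<Sum>n<M. a n) = (\<Sum>q<M div p. \<Sum>j<p. a (q * p + j)) + (\<Sum>j<M mod p. a (M div p * p + j))" for M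
  proof -
    have "(\<Sum>n<M. a n) = (\<Sum>n<M div p * p + M mod p. a n)" by simp
    also have "\<dots> = (\<Sum>n<M div p * p. a n) + (\<Sum>n\<in>{M div p * p..<M div p * p + M mod p}. a n)"
      using sum.atLeastLessThan_concat[of 0 "M div p * p" "M div p * p + M mod p" a]
      by (simp only: lessThan_atLeast0)
    also have "(\<Sum>n\<in>{M div p * p..<M div p * p + M mod p}. a n) = (\<Sum>j<M mod p. a (M div p * p + j))"
      using sum.shift_bounds_nat_ivl[of a 0 "M div p * p" "M mod p"] by (simp only: add_ac lessThan_atLeast0 add_0_left)
    finally show ?thesis by (simp add: sum_blocks)
  qed
  ultimately show ?thesis by (simp add: sums_def)
qed

text \<open>Within each block the residues x and p - x are averaged; oddness of f produces the terms
  of \<open>sums_cot\<close> at z = x/p. The averaging gives the 1/2 and the rescaling the 1/p in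
  the constant.\<close>

lemma sums_odd_periodic:
  fixes f :: "nat \<Rightarrow> complex"
  assumes p: "p > 0" and per: "\<And>n. f (n + p) = f n" and f0: "f 0 = 0"
    and odd: "\<And>x. x \<in> {1..<p} \<Longrightarrow> f (p - x) = - f x"
  shows "(\<lambda>n. f (Suc n) / of_nat (Suc n)) sums
           (of_real (pi / (2 * p)) * (\<Sum>x\<in>{1..<p}. f x * of_real (cot (pi * x / p))))"
proof (rule sums_from_blocks[OF p])
  have per': "f (q * p + x) = f x" for q x
  proof (induction q)
    case (Suc q)
    have "f (Suc q * p + x) = f (q * p + x + p)" by (simp add: add_ac)
    thus ?case using per[of "q * p + x"] Suc.IH by simp
  qed simp
  have "(\<lambda>q. \<Sum>x\<in>{1..<p}. of_real (1 / (2 * p)) * (f x * of_real (1 / (real q + x / p) - 1 / (real q + 1 - x / p))))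
      sums (\<Sum>x\<in>{1..<p}. of_real (1 / (2 * p)) * (f x * of_real (pi * cot (pi * (x / p)))))"
    by (intro sums_sum sums_mult sums_of_real sums_cot) auto
  also have "(\<Sum>x\<in>{1..<p}. of_real (1 / (2 * p)) * (f x * of_real (pi * cot (pi * (x / p))))) =
      of_real (pi / (2 * p)) * (\<Sum>x\<in>{1..<p}. f x * of_real (cot (pi * x / p)))"
    by (simp add: sum_distrib_left mult_ac)
  also have "(\<lambda>q. \<Sum>x\<in>{1..<p}. of_real (1 / (2 * p)) * (f x * of_real (1 / (real q + x / p) - 1 / (real q + 1 - x / p))))
      = (\<lambda>q. \<Sum>j<p. f (Suc (q * p + j)) / of_nat (Suc (q * p + j)))"
  proof
    fix q
    let ?g = "\<lambda>x. f x / of_nat (q * p + x)"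
    have "(\<Sum>j<p. f (Suc (q * p + j)) / of_nat (Suc (q * p + j))) = (\<Sum>j<p. ?g (Suc j))"
      using per'[of q "Suc _"] by simp
    also have "\<dots> = (\<Sum>x\<in>{1..p}. ?g x)"
      by (rule sum.reindex_bij_witness[of _ "\<lambda>x. x - 1" Suc]) auto
    \<comment> \<open>The series starts at 1, so a block runs over residues 1, ..., p; the last one
      contributes f p = f 0 = 0.\<close>
    also have "{1..p} = insert p {1..<p}" using p by auto
    also have "sum ?g \<dots> = (\<Sum>x\<in>{1..<p}. ?g x)" using per[of 0] f0 by simp
    finally have 1: "(\<Sum>j<p. f (Suc (q * p + j)) / of_nat (Suc (q * p + j))) = (\<Sum>x\<in>{1..<p}. ?g x)" .
    have 2: "(\<Sum>x\<in>{1..<p}. ?g x) = (\<Sum>x\<in>{1..<p}. ?g (p - x))"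
      by (rule sum.reindex_bij_witness[of _ "\<lambda>x. p - x" "\<lambda>x. p - x"]) auto
    have "(\<Sum>x\<in>{1..<p}. ?g x) = of_real (1 / 2) * ((\<Sum>x\<in>{1..<p}. ?g x) + (\<Sum>x\<in>{1..<p}. ?g (p - x)))"
      unfolding 2[symmetric] by simp
    also have "\<dots> = (\<Sum>x\<in>{1..<p}. of_real (1 / 2) * (?g x + ?g (p - x)))"
      by (simp only: sum.distrib[symmetric] sum_distrib_left)
    also have "\<dots> = (\<Sum>x\<in>{1..<p}. of_real (1 / (2 * p)) * (f x * of_real (1 / (real q + x / p) - 1 / (real q + 1 - x / p))))"
    proof (intro sum.cong refl)
      fix x assume x: "x \<in> {1..<p}"
      have "real q + x / p = (real q * p + x) / p" "real q + 1 - x / p = (real q * p + (real p - x)) / p"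
        using p by (simp_all add: add_divide_distrib diff_divide_distrib)
      hence "1 / (real q + x / p) - 1 / (real q + 1 - x / p) = p * (1 / (real q * p + x) - 1 / (real q * p + (real p - x)))"
        by (simp add: right_diff_distrib)
      hence "of_real (1 / (2 * p)) * (f x * of_real (1 / (real q + x / p) - 1 / (real q + 1 - x / p)))
          = of_real (1 / (2 * p)) * (f x * of_real (p * (1 / (real q * p + x) - 1 / (real q * p + (real p - x)))))"
        by (simp only:)
      also have "\<dots> = of_real (1 / 2) * (f x * of_real (1 / (real q * p + x) - 1 / (real q * p + (real p - x))))"
        using p by simp
      also have "\<dots> = of_real (1 / 2) * (?g x + ?g (p - x))"
        using odd[OF x] x by (simp add: algebra_simps of_nat_diff)
      finally show "of_real (1 / 2) * (?g x + ?g (p - x)) =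
        of_real (1 / (2 * p)) * (f x * of_real (1 / (real q + x / p) - 1 / (real q + 1 - x / p)))" ..
    qed
    finally show "(\<Sum>x\<in>{1..<p}. of_real (1 / (2 * p)) * (f x * of_real (1 / (real q + x / p) - 1 / (real q + 1 - x / p))))
      = (\<Sum>j<p. f (Suc (q * p + j)) / of_nat (Suc (q * p + j)))"
      using 1 by simp
  qed
  finally show "(\<lambda>q. \<Sum>j<p. f (Suc (q * p + j)) / of_nat (Suc (q * p + j))) sums
      (of_real (pi / (2 * p)) * (\<Sum>x\<in>{1..<p}. f x * of_real (cot (pi * x / p))))" .
  \<comment> \<open>The remaining premise: a periodic f is bounded, hence the terms tend to
    0.\<close>
  define B where "B = (\<Sum>x<p. norm (f x))"
  have "norm (f n) \<le> B" for n
  proof -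
    have "f n = f (n mod p)" using per'[of "n div p" "n mod p"] by simp
    also have "norm \<dots> \<le> B" unfolding B_def using p by (intro member_le_sum) auto
    finally show ?thesis .
  qed
  hence le: "norm (f (Suc n) / of_nat (Suc n)) \<le> B * inverse (real (Suc n))" for n
    unfolding norm_divide norm_of_nat by (simp only: divide_inverse) (rule mult_right_mono, auto)
  have "(\<lambda>n. B * inverse (real (Suc n))) \<longlonglongrightarrow> 0"
    by (rule tendsto_mult_right_zero[OF LIMSEQ_inverse_real_of_nat])
  thus "(\<lambda>n. f (Suc n) / of_nat (Suc n)) \<longlonglongrightarrow> 0"
    by (rule Lim_null_comparison[rotated]) (intro always_eventually allI le)
qed

section \<open>Cotangent estimates and the diagonal term\<close>

lemma cot_add_int_pi: "cot (x + pi * of_int k) = cot x"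
  by (simp add: cot_def sin_add cos_add sin_npi_int cos_npi_int)

lemma cot_pi_frac_cong:
  assumes "[m = n] (mod int p)"
  shows "cot (pi * of_int m / p) = cot (pi * of_int n / p)"
proof (cases "p = 0")
  case False
  obtain k where "m - n = int p * k" using assms by (auto simp: cong_iff_dvd_diff elim: dvdE)
  hence "real_of_int (m - n) = p * real_of_int k" by simp
  hence "real_of_int m = of_int n + p * of_int k" by simp
  hence "pi * of_int m / p = pi * of_int n / p + pi * of_int k"
    using False by (simp add: distrib_left add_divide_distrib)
  thus ?thesis by (simp add: cot_add_int_pi)
qed simp

text \<open>The function sin v - v cos v vanishes at 0 and has derivative v sin v >= 0, so u cos u
  <= sin u; negative arguments follow by symmetry.\<close>

lemma abs_cot_le:
  assumes "0 < \<bar>t\<bar>" "\<bar>t\<bar> < pi / 2"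
  shows "\<bar>cot t\<bar> \<le> 1 / \<bar>t\<bar>"
proof -
  have "cot u \<le> 1 / u" "0 \<le> cot u" if "0 < u" "u < pi / 2" for u
  proof -
    have "sin 0 - 0 * cos 0 \<le> sin u - u * cos u"
    proof (rule DERIV_nonneg_imp_nondecreasing[of 0 u "\<lambda>v. sin v - v * cos v"])
      fix v assume "0 \<le> v" "v \<le> u"
      hence "0 \<le> v * sin v" using that by (intro mult_nonneg_nonneg sin_ge_zero) auto
      thus "\<exists>y. ((\<lambda>v. sin v - v * cos v) has_real_derivative y) (at v) \<and> 0 \<le> y"
        by (intro exI[of _ "v * sin v"] conjI) (auto intro!: derivative_eq_intros)
    qed (use that in simp)
    moreover have "cos u > 0" "sin u > 0" using that by (auto intro: cos_gt_zero sin_gt_zero)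
    ultimately show "cot u \<le> 1 / u" "0 \<le> cot u" using that by (simp_all add: cot_def field_simps)
  qed
  from this[of "\<bar>t\<bar>"] assms show ?thesis by (cases "t > 0") (auto simp: abs_if)
qed

lemma cot_square_ge: "0 < t \<Longrightarrow> t < pi \<Longrightarrow> 1 / t\<^sup>2 - 1 \<le> (cot t)\<^sup>2"
proof -
  assume t: "0 < t" "t < pi"
  have s: "sin t > 0" "sin t \<le> t" using t sin_gt_zero sin_x_le_x by auto
  have "(cot t)\<^sup>2 = 1 / (sin t)\<^sup>2 - 1"
    using s(1) by (simp add: cot_def power_divide cos_squared_eq diff_divide_distrib)
  moreover have "1 / t\<^sup>2 \<le> 1 / (sin t)\<^sup>2" using s by (intro divide_left_mono power_mono) auto
  ultimately show ?thesis by simp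
qed

lemma sum_int_symmetric:
  fixes g :: "int \<Rightarrow> 'a :: comm_semiring_1"
  assumes p: "odd p" and g: "\<And>x. x \<in> {1..int p - 1} \<Longrightarrow> g (int p - x) = g x"
  shows "(\<Sum>x\<in>{1..int p - 1}. g x) = 2 * (\<Sum>x\<in>{1..(int p - 1) div 2}. g x)"
proof -
  obtain k where k: "p = 2 * k + 1" using p by (elim oddE)
  have "{1..int p - 1} = {1..int k} \<union> {int k + 1..int p - 1}" using k by auto
  hence "(\<Sum>x\<in>{1..int p - 1}. g x) = (\<Sum>x\<in>{1..int k}. g x) + (\<Sum>x\<in>{int k + 1..int p - 1}. g x)"
    by (simp add: sum.union_disjoint)
  also have "(\<Sum>x\<in>{int k + 1..int p - 1}. g x) = (\<Sum>x\<in>{int k + 1..int p - 1}. g (int p - x))"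
    by (intro sum.cong refl g[symmetric]) auto
  also have "\<dots> = (\<Sum>x\<in>{1..int k}. g x)"
    by (rule sum.reindex_bij_witness[of _ "\<lambda>x. int p - x" "\<lambda>x. int p - x"]) (use k in auto)
  finally have "(\<Sum>x\<in>{1..int p - 1}. g x) = 2 * (\<Sum>x\<in>{1..int k}. g x)" by (simp only: mult_2)
  moreover have "(int p - 1) div 2 = int k" using k by simp
  ultimately show ?thesis by simp
qed

lemma sum_inverse_squares_tail:
  assumes "n > 0"
  shows "\<bar>(\<Sum>k=1..n. 1 / (real k)\<^sup>2) - pi\<^sup>2 / 6\<bar> \<le> 1 / n"
proof -
  let ?a = "\<lambda>k. 1 / (real k + 1)\<^sup>2"
  have shift: "(\<Sum>k=1..m. 1 / (real k)\<^sup>2) = (\<Sum>k<m. ?a k)" for m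
    by (rule sum.reindex_bij_witness[of _ Suc "\<lambda>k. k - 1"]) auto
  have sums: "?a sums (pi\<^sup>2 / 6)" using inverse_squares_sums by (simp add: add.commute)
  have "(\<Sum>k<n. ?a k) \<le> pi\<^sup>2 / 6"
    using sum_le_suminf[OF sums_summable[OF sums], of "{..<n}"] sums by (simp add: sums_iff)
  moreover have "pi\<^sup>2 / 6 \<le> (\<Sum>k<n. ?a k) + 1 / n"
  proof (rule LIMSEQ_le_const2)
    show "(\<lambda>m. \<Sum>k<m. ?a k) \<longlonglongrightarrow> pi\<^sup>2 / 6" using sums by (simp add: sums_def)
    \<comment> \<open>Strengthened by - 1/m for the induction: the increment is at most 1/(m(m + 1))
      and telescopes.\<close>
    have le: "(\<Sum>k<m. ?a k) \<le> (\<Sum>k<n. ?a k) + 1 / n - 1 / m" if "m \<ge> n" for m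
      using that
    proof (induction m rule: dec_induct)
      case (step m)
      have m: "real m > 0" using step assms by simp
      have "?a m \<le> 1 / (real m * (real m + 1))"
        using m by (intro divide_left_mono) (auto simp: power2_eq_square)
      also have "\<dots> = 1 / m - 1 / Suc m" using m by (simp add: field_simps)
      finally show ?case using step.IH by simp
    qed simp
    show "\<exists>N. \<forall>m\<ge>N. (\<Sum>k<m. ?a k) \<le> (\<Sum>k<n. ?a k) + 1 / n"
    proof (intro exI allI impI)
      fix m assume "n \<le> m"
      moreover have "0 \<le> 1 / real m" by simp
      ultimately show "(\<Sum>k<m. ?a k) \<le> (\<Sum>k<n. ?a k) + 1 / n" using le[of m] by linarith
    qed
  qed
  ultimately show ?thesis unfolding shift by linarith
qed

text \<open>The main term, h = 1. With t = pi k/p, the bounds 1/t^2 - 1 <= cot(t)^2 <= 1/t^2 compare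
  the sum with a partial sum of the inverse squares. The error 19/p is 16/p from the subtracted ones
  (pi < 4) plus 3/p from the tail (p <= 3n).\<close>

lemma sum_cot_square:
  assumes p: "odd p" "p \<ge> 3"
  shows "\<bar>pi\<^sup>2 / (2 * (real p)\<^sup>2) * (\<Sum>x\<in>{1..int p - 1}. (cot (pi * of_int x / p))\<^sup>2) - pi\<^sup>2 / 6\<bar> \<le> 19 / p"
proof -
  obtain n where n: "p = 2 * n + 1" using p by (elim oddE)
  have n0: "n > 0" using n p by simp
  have "cot (pi * of_int (int p - x) / p) = - cot (pi * of_int x / p)" for x
    using cot_pi_frac_cong[of "int p - x" "- x" p] by (simp add: cong_iff_dvd_diff flip: cot_minus)
  hence "(\<Sum>x\<in>{1..int p - 1}. (cot (pi * of_int x / p))\<^sup>2) = 2 * (\<Sum>x\<in>{1..(int p - 1) div 2}. (cot (pi * of_int x / p))\<^sup>2)"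
    by (intro sum_int_symmetric p) simp
  also have "(\<Sum>x\<in>{1..(int p - 1) div 2}. (cot (pi * of_int x / p))\<^sup>2) = (\<Sum>k=1..n. (cot (pi * k / p))\<^sup>2)"
    by (rule sum.reindex_bij_witness[of _ int nat]) (auto simp: n)
  finally have eq: "pi\<^sup>2 / (2 * (real p)\<^sup>2) * (\<Sum>x\<in>{1..int p - 1}. (cot (pi * of_int x / p))\<^sup>2)
      = (\<Sum>k=1..n. (pi / p)\<^sup>2 * (cot (pi * k / p))\<^sup>2)"
    by (simp add: sum_distrib_left power_divide)
  have bounds: "(pi / p)\<^sup>2 * (cot (pi * k / p))\<^sup>2 \<le> 1 / (real k)\<^sup>2"
       "1 / (real k)\<^sup>2 - (pi / p)\<^sup>2 \<le> (pi / p)\<^sup>2 * (cot (pi * k / p))\<^sup>2" if k: "k \<in> {1..n}" for k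
  proof -
    have "pi * (2 * real k) < pi * real p" using k n by (intro mult_strict_left_mono) auto
    hence t: "0 < pi * k / p" "pi * k / p < pi / 2" using k n by (simp_all add: field_simps)
    have eq: "(pi / p)\<^sup>2 * (1 / (pi * k / p)\<^sup>2) = 1 / (real k)\<^sup>2"
      using k n by (simp add: field_simps)
    have "\<bar>cot (pi * k / p)\<bar> \<le> 1 / \<bar>pi * k / p\<bar>" using t by (intro abs_cot_le) linarith+
    hence "\<bar>cot (pi * k / p)\<bar>\<^sup>2 \<le> (1 / \<bar>pi * k / p\<bar>)\<^sup>2" by (intro power_mono) auto
    hence "(cot (pi * k / p))\<^sup>2 \<le> 1 / (pi * k / p)\<^sup>2" by (simp add: power_divide)
    from mult_left_mono[OF this, of "(pi / p)\<^sup>2"] show "(pi / p)\<^sup>2 * (cot (pi * k / p))\<^sup>2 \<le> 1 / (real k)\<^sup>2"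
      by (simp only: eq zero_le_power2)
    have "1 / (pi * k / p)\<^sup>2 - 1 \<le> (cot (pi * k / p))\<^sup>2" using t pi_gt_zero by (intro cot_square_ge) linarith+
    from mult_left_mono[OF this, of "(pi / p)\<^sup>2"]
    show "1 / (real k)\<^sup>2 - (pi / p)\<^sup>2 \<le> (pi / p)\<^sup>2 * (cot (pi * k / p))\<^sup>2"
      by (simp only: eq zero_le_power2 right_diff_distrib mult_1_right)
  qed
  have "(\<Sum>k=1..n. (pi / p)\<^sup>2 * (cot (pi * k / p))\<^sup>2) \<le> (\<Sum>k=1..n. 1 / (real k)\<^sup>2)"
    by (intro sum_mono bounds)
  moreover have "(\<Sum>k=1..n. 1 / (real k)\<^sup>2 - (pi / p)\<^sup>2) \<le> (\<Sum>k=1..n. (pi / p)\<^sup>2 * (cot (pi * k / p))\<^sup>2)"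
    by (intro sum_mono bounds)
  moreover have "(\<Sum>k=1..n. 1 / (real k)\<^sup>2 - (pi / p)\<^sup>2) = (\<Sum>k=1..n. 1 / (real k)\<^sup>2) - n * (pi / p)\<^sup>2"
    by (simp add: sum_subtractf)
  moreover have "n * (pi / p)\<^sup>2 \<le> 16 / p"
  proof -
    have "real n * pi\<^sup>2 \<le> real p * 4\<^sup>2" using n pi_less_4 by (intro mult_mono power_mono) auto
    thus ?thesis using p by (simp add: power_divide power2_eq_square[of "real p"] field_simps)
  qed
  moreover have "1 / n \<le> 3 / p"
  proof -
    have "real p \<le> 3 * real n" using n n0 by linarith
    moreover have "real p > 0" using p by simp
    ultimately show ?thesis using n0 by (simp add: divide_le_eq pos_le_divide_eq mult.commute)
  qed
  moreover have "16 / p + 3 / p = 19 / real p" by simp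
  ultimately show ?thesis unfolding eq using sum_inverse_squares_tail[OF n0] unfolding abs_le_iff by linarith
qed

section \<open>The second moment as a correlation of cotangents\<close>

lemma Fp_units_power:
  assumes "Factorial_Ring.prime p" "x \<in> carrier (Fp_units p)"
  shows "x [^]\<^bsub>Fp_units p\<^esub> (k::nat) = x ^ k mod int p"
proof -
  interpret G: group "Fp_units p" by (rule Fp_units_group[OF assms(1)])
  have "\<one>\<^bsub>Fp_units p\<^esub> = 1"
    using prime_gt_1_nat[OF assms(1)]
    by (simp add: Fp_units_def Multiplicative_Group.mult_of_def residue_ring_def)
  show ?thesis
  proof (induction k)
    case 0
    show ?case using \<open>\<one>\<^bsub>Fp_units p\<^esub> = 1\<close> prime_gt_1_nat[OF assms(1)] by simp
  next
    case (Suc k)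
    have "x [^]\<^bsub>Fp_units p\<^esub> Suc k = (x ^ k mod int p) \<otimes>\<^bsub>Fp_units p\<^esub> x"
      by (simp add: Suc.IH)
    also have "\<dots> = x ^ Suc k mod int p"
      by (simp add: Fp_units_explicit(2)[OF assms(1)] mod_mult_right_eq mult.commute)
    finally show ?case .
  qed
qed

lemma card_unity_roots_mod_le:
  assumes p: "Factorial_Ring.prime p" and d: "d > 0"
  shows "card (unity_roots_mod p d) \<le> d"
proof -
  interpret residues_prime p "residue_ring (int p)"
    by unfold_locales (use p in auto)
  let ?R = "residue_ring (int p)"
  let ?T = "{x \<in> carrier ?R. x [^]\<^bsub>?R\<^esub> d = \<one>\<^bsub>?R\<^esub>}"
  have "unity_roots_mod p d \<subseteq> ?T"
  proof
    fix x assume x: "x \<in> unity_roots_mod p d"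
    hence "x \<in> carrier (Fp_units p)" by (simp add: unity_roots_mod_def Fp_units_explicit(1)[OF p])
    hence "x [^]\<^bsub>Fp_units p\<^esub> d = x ^ d mod int p" by (rule Fp_units_power[OF p])
    hence "x [^]\<^bsub>?R\<^esub> d = x ^ d mod int p" by (simp add: Fp_units_def Multiplicative_Group.nat_pow_mult_of)
    also have "\<dots> = 1" using x prime_gt_1_nat[OF p] by (simp add: unity_roots_mod_def Cong.cong_def)
    finally show "x \<in> ?T" using x by (auto simp: unity_roots_mod_def residue_ring_def)
  qed
  hence "card (unity_roots_mod p d) \<le> card ?T" by (rule card_mono[rotated]) (use finite in auto)
  also have "\<dots> \<le> d" using num_roots_le_deg[OF finite, of d] d finite by auto
  finally show ?thesis .
qed

text \<open>By Lagrange the subgroup has d elements, all of them d-th roots of unity; a field has at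
  most d such roots, so inclusion is equality.\<close>

lemma index_subgroup_eq:
  assumes p: "Factorial_Ring.prime p" and m: "m dvd p - 1"
  shows "index_subgroup p m = unity_roots_mod p ((p - 1) div m)"
proof -
  define d where "d = (p - 1) div m"
  have p1: "p - 1 > 0" using prime_gt_1_nat[OF p] by simp
  have md: "m * d = p - 1" using m by (simp add: d_def)
  have pos: "m > 0" "d > 0" using md p1 by (auto intro: Nat.gr0I)
  interpret G: group "Fp_units p" by (rule Fp_units_group[OF p])
  let ?H = "index_subgroup p m"
  have H: "subgroup ?H (Fp_units p)" "card (rcosets\<^bsub>Fp_units p\<^esub> ?H) = m"
    unfolding index_subgroup_def using theI'[OF ex1_index_subgroup[OF p m]] by auto
  have "m * card ?H = m * d"
    using G.lagrange[OF H(1)] H(2) Fp_units_group(3)[OF p] md by simp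
  hence cardH: "card ?H = d" using pos by simp
  have "?H \<subseteq> unity_roots_mod p d"
  proof
    fix h assume h: "h \<in> ?H"
    have hc: "h \<in> carrier (Fp_units p)" using H h subgroup.subset by blast
    interpret HG: group "(Fp_units p)\<lparr>carrier := ?H\<rparr>" by (rule subgroup.subgroup_is_group[OF H(1) G.is_group])
    have "h [^]\<^bsub>(Fp_units p)\<lparr>carrier := ?H\<rparr>\<^esub> d = \<one>\<^bsub>Fp_units p\<^esub>"
      using HG.pow_order_eq_1[of h] h cardH by (simp add: Coset.order_def)
    hence "h ^ d mod int p = \<one>\<^bsub>Fp_units p\<^esub>"
      using Fp_units_power[OF p hc, of d] by (simp add: nat_pow_def)
    hence "h ^ d mod int p = 1"
      by (simp add: Fp_units_def Multiplicative_Group.mult_of_def residue_ring_def)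
    thus "h \<in> unity_roots_mod p d"
      using hc p1 by (simp add: unity_roots_mod_def Cong.cong_def Fp_units_explicit(1)[OF p])
  qed
  moreover have "finite (unity_roots_mod p d)"
    by (rule finite_subset[of _ "{1..int p - 1}"]) (auto simp: unity_roots_mod_def)
  ultimately show ?thesis
    using card_unity_roots_mod_le[OF p pos(2)] cardH card_seteq unfolding d_def by metis
qed

section \<open>Odd characters parametrised by the solutions of w^M = -1\<close>

lemma power_cong_exponent:
  fixes w :: "'a :: monoid_mult"
  assumes "w ^ n = 1" "[i = j] (mod n)"
  shows "w ^ i = w ^ j"
proof -
  have "w ^ i = w ^ (i mod n)" for i
  proof -
    have "w ^ (n * (i div n) + i mod n) = w ^ (i mod n)"
      unfolding power_add power_mult assms(1) by simp
    thus ?thesis by simp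
  qed
  thus ?thesis using assms(2) unfolding Cong.cong_def by metis
qed

text \<open>If M divides a, every term is (-1)^(a/M). Otherwise multiplication by a primitive M-th
  root of unity z permutes the solutions and scales the sum by z^a, which is not 1.\<close>

lemma sum_powers_roots_neg_one:
  assumes "M > 0"
  shows "(\<Sum>w\<in>{w::complex. w ^ M = -1}. w ^ a)
    = (if [a = 0] (mod 2 * M) then of_nat M else if [a = M] (mod 2 * M) then - of_nat M else 0)"
proof (cases "M dvd a")
  case True
  then obtain k where k: "a = M * k" by auto
  have "(\<Sum>w\<in>{w::complex. w ^ M = -1}. w ^ a) = (\<Sum>w\<in>{w::complex. w ^ M = -1}. (-1) ^ k)"
    by (intro sum.cong refl) (simp add: k power_mult)
  also have "\<dots> = of_nat M * (-1) ^ k" using card_nth_roots[of "-1" M] assms by simp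
  finally have eq: "(\<Sum>w\<in>{w::complex. w ^ M = -1}. w ^ a) = of_nat M * (-1) ^ k" .
  show ?thesis
  proof (cases "even k")
    case True
    then obtain j where "k = 2 * j" by auto
    hence "[a = 0] (mod 2 * M)" by (simp add: k cong_0_iff)
    thus ?thesis using True eq by simp
  next
    case False
    then obtain j where j: "k = 2 * j + 1" by (elim oddE)
    hence a: "a = M + 2 * M * j" by (simp add: k algebra_simps)
    have "[a = M] (mod 2 * M)" unfolding a by (simp add: Cong.cong_def)
    moreover have "a mod (2 * M) = M" unfolding a using assms by simp
    hence "\<not> [a = 0] (mod 2 * M)" using assms by (simp add: Cong.cong_def)
    ultimately show ?thesis using False eq by simp
  qed
next
  case False
  have ncong: "\<not> [a = 0] (mod 2 * M)" "\<not> [a = M] (mod 2 * M)"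
    using False cong_dvd_iff[of a 0 M] cong_dvd_iff[of a M M] cong_modulus_mult_nat[of a _ M 2]
    by (auto simp: mult.commute)
  define z where "z = cis (2 * pi / M)"
  have zM: "z ^ M = 1" using assms by (simp add: z_def Complex.DeMoivre)
  have za: "z ^ a \<noteq> 1"
  proof
    assume "z ^ a = 1"
    hence "cis (2 * pi * a / M) = 1" by (simp add: z_def Complex.DeMoivre mult_ac)
    hence "cos (2 * pi * a / M) = 1" by (simp add: complex_eq_iff)
    then obtain n :: int where "2 * pi * a / M = n * 2 * pi" by (auto simp: cos_one_2pi_int)
    hence "real a = n * M" using assms by (simp add: field_simps)
    hence "real_of_int (int a) = real_of_int (n * int M)" by simp
    hence "int a = n * int M" by (simp only: of_int_eq_iff)
    hence "int M dvd int a" by simp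
    thus False using False by simp
  qed
  have "z \<noteq> 0" by (simp add: z_def)
  let ?S = "\<Sum>w\<in>{w::complex. w ^ M = -1}. w ^ a"
  have "?S = (\<Sum>w\<in>{w::complex. w ^ M = -1}. (z * w) ^ a)"
    by (rule sum.reindex_bij_witness[of _ "\<lambda>w. z * w" "\<lambda>w. w / z"])
       (use \<open>z \<noteq> 0\<close> zM in \<open>auto simp: power_mult_distrib power_divide\<close>)
  also have "\<dots> = z ^ a * ?S" by (simp add: power_mult_distrib sum_distrib_left)
  finally have "?S = 0" using za by auto
  thus ?thesis using ncong by simp
qed

text \<open>The setting of the theorem with a primitive root \<open>g\<close> fixed: all characters
  are read off from their value at \<open>g\<close>.\<close>

locale odd_index =
  fixes p m d M g :: nat
  assumes prime: "Factorial_Ring.prime p" and odd_p: "odd p" and md: "m * d = p - 1"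
    and m: "m = 2 * M" and odd_d: "odd d" and g: "residue_primroot p g"
begin

lemma p_gt_2: "p > 2"
  using prime_gt_1_nat[OF prime] odd_p by (cases "p = 2") auto

lemma M_pos: "M > 0" and d_pos: "d > 0"
  using md m p_gt_2 by (auto intro: Nat.gr0I)

lemma gpow_cong_iff: "[int g ^ i = int g ^ j] (mod int p) \<longleftrightarrow> [i = j] (mod p - 1)"
proof -
  have "coprime p g" "Pocklington.ord p g = p - 1"
    using g prime by (auto simp: residue_primroot_def totient_prime)
  hence "[g ^ i = g ^ j] (mod p) \<longleftrightarrow> [i = j] (mod p - 1)" by (simp add: order_divides_expdiff)
  thus ?thesis by (metis cong_int_iff of_nat_power)
qed

text \<open>The discrete logarithm to base \<open>g\<close>, an arbitrary representative that
  matters only modulo p - 1.\<close>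

definition "index x = (SOME i. [int g ^ i = x] (mod int p))"

lemma cong_index:
  assumes "x \<in> {1..int p - 1}"
  shows "[int g ^ index x = x] (mod int p)"
proof -
  have "nat x \<in> totatives p" using assms prime by (auto simp: totatives_prime)
  also have "totatives p = (\<lambda>i. g ^ i mod p) ` {..<totient p}"
    using residue_primroot_is_generator[OF _ g] p_gt_2 by (simp add: bij_betw_def)
  finally obtain i where "nat x = g ^ i mod p" by auto
  hence "x = int g ^ i mod int p" using assms by (metis atLeastAtMost_iff int_nat_eq of_nat_mod of_nat_power zero_le_one order_trans)
  hence "[int g ^ i = x] (mod int p)" by (simp add: Cong.cong_def)
  thus ?thesis unfolding index_def by (rule someI)
qed

lemma cong_imp_index:
  assumes "x \<in> {1..int p - 1}" "[int g ^ i = x] (mod int p)"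
  shows "[index x = i] (mod p - 1)"
  using cong_trans[OF cong_index[OF assms(1)] cong_sym[OF assms(2)]] by (simp add: gpow_cong_iff)

lemma index_mult:
  assumes "x \<in> {1..int p - 1}" "y \<in> {1..int p - 1}" "x * y mod int p \<in> {1..int p - 1}"
  shows "[index (x * y mod int p) = index x + index y] (mod p - 1)"
proof (rule cong_imp_index[OF assms(3)])
  have "[int g ^ index x * int g ^ index y = x * y] (mod int p)"
    by (intro cong_mult cong_index assms)
  thus "[int g ^ (index x + index y) = x * y mod int p] (mod int p)"
    by (simp add: power_add)
qed

lemma power_cong_one_iff:
  assumes "x \<in> {1..int p - 1}"
  shows "[x ^ d = 1] (mod int p) \<longleftrightarrow> [index x = 0] (mod m)"
proof -
  have "[x ^ d = 1] (mod int p) \<longleftrightarrow> [int g ^ (index x * d) = int g ^ 0] (mod int p)"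
    using cong_pow[OF cong_index[OF assms], of d] by (simp add: power_mult) (metis cong_sym cong_trans)
  also have "\<dots> \<longleftrightarrow> m * d dvd index x * d" unfolding gpow_cong_iff md cong_0_iff ..
  also have "\<dots> \<longleftrightarrow> [index x = 0] (mod m)" using d_pos by (simp add: cong_0_iff)
  finally show ?thesis .
qed

text \<open>The square of this power is g^(p - 1) = 1, and the power itself is not 1 because m d
  does not divide M d.\<close>

lemma gpow_neg_one: "[int g ^ (M * d) = - 1] (mod int p)"
proof -
  have "M * d + M * d = p - 1" unfolding md[symmetric] m by simp
  hence "int g ^ (M * d) * int g ^ (M * d) = int g ^ (p - 1)" by (simp flip: power_add)
  moreover have "[int g ^ (p - 1) = int g ^ 0] (mod int p)" unfolding gpow_cong_iff by (simp add: cong_0_iff)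
  ultimately have "int p dvd (int g ^ (M * d) - 1) * (int g ^ (M * d) + 1)"
    by (simp add: cong_iff_dvd_diff algebra_simps)
  moreover have "\<not> int p dvd int g ^ (M * d) - 1"
  proof
    assume "int p dvd int g ^ (M * d) - 1"
    hence "[int g ^ (M * d) = int g ^ 0] (mod int p)" by (simp add: cong_iff_dvd_diff)
    hence "m * d dvd M * d" unfolding gpow_cong_iff md by (simp add: cong_0_iff)
    hence "2 * M dvd M" using d_pos m by simp
    thus False using M_pos by (auto dest: dvd_imp_le)
  qed
  ultimately have "int p dvd int g ^ (M * d) + 1" using prime by (simp add: prime_dvd_mult_iff)
  thus ?thesis by (simp add: cong_iff_dvd_diff)
qed

lemma power_cong_neg_one_iff:
  assumes "x \<in> {1..int p - 1}"
  shows "[x ^ d = - 1] (mod int p) \<longleftrightarrow> [index x = M] (mod m)"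
proof -
  have "[x ^ d = - 1] (mod int p) \<longleftrightarrow> [int g ^ (index x * d) = int g ^ (M * d)] (mod int p)"
    using cong_pow[OF cong_index[OF assms], of d] gpow_neg_one
    by (simp add: power_mult) (metis cong_sym cong_trans)
  also have "\<dots> \<longleftrightarrow> [index x * d = M * d] (mod m * d)" unfolding gpow_cong_iff md ..
  also have "\<dots> \<longleftrightarrow> [index x = M] (mod m)"
    using d_pos by (simp add: Cong.cong_def mult_mod_left[symmetric])
  finally show ?thesis .
qed

text \<open>The character with value w at the generator; \<open>restrict\<close> matches the
  extensionality built into \<open>mult_chars\<close>.\<close>

definition "root_char w = restrict (\<lambda>x. w ^ index x) {1..int p - 1}" for w :: complex

text \<open>The possible values at \<open>g\<close> of odd characters trivial on the subgroup:
  triviality means w^m = 1, and oddness w^(M d) = -1, which for odd d and m = 2M amounts to w^M =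
  -1.\<close>

definition "W = {w :: complex. w ^ M = -1}"

lemma W_power: assumes "w \<in> W" shows "w ^ m = 1" "w ^ (p - 1) = 1" "norm w = 1"
proof -
  have "w ^ m = (w ^ M) ^ 2" unfolding m by (simp add: power_mult[symmetric] mult.commute)
  thus 1: "w ^ m = 1" using assms by (simp add: W_def)
  show "w ^ (p - 1) = 1" unfolding md[symmetric] power_mult 1 by simp
  show "norm w = 1" using 1 power_eq_1_iff[of w m] M_pos m by auto
qed

lemma carrier: "carrier (Fp_units p) = {1..int p - 1}"
  by (rule Fp_units_explicit(1)[OF prime])

lemma root_char_gpow:
  assumes "w \<in> W" "x \<in> {1..int p - 1}" "[int g ^ i = x] (mod int p)"
  shows "root_char w x = w ^ i"
  using power_cong_exponent[OF W_power(2)[OF assms(1)] cong_imp_index[OF assms(2,3)]] assms(2)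
  by (simp add: root_char_def)

lemma mult_closed:
  assumes "x \<in> {1..int p - 1}" "y \<in> {1..int p - 1}"
  shows "x * y mod int p \<in> {1..int p - 1}"
proof -
  interpret G: group "Fp_units p" by (rule Fp_units_group[OF prime])
  show ?thesis using G.m_closed[of x y] assms by (simp add: carrier Fp_units_explicit(2)[OF prime])
qed

lemma index_subgroup: "index_subgroup p m = unity_roots_mod p d"
proof -
  have "m dvd p - 1" "(p - 1) div m = d" unfolding md[symmetric] using m M_pos by simp_all
  thus ?thesis using index_subgroup_eq[OF prime] by metis
qed

lemma root_char_mult:
  assumes "w \<in> W" "x \<in> {1..int p - 1}" "y \<in> {1..int p - 1}"
  shows "root_char w (x * y mod int p) = root_char w x * root_char w y"
  using power_cong_exponent[OF W_power(2)[OF assms(1)] index_mult[OF assms(2,3) mult_closed[OF assms(2,3)]]]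
    mult_closed[OF assms(2,3)] assms
  by (simp add: root_char_def power_add)

lemma root_char_mem:
  assumes w: "w \<in> W"
  shows "root_char w \<in> odd_chars_trivial_on p m"
proof -
  have w0: "w \<noteq> 0" using W_power(3)[OF w] by auto
  have "root_char w \<in> mult_chars p"
    unfolding mult_chars_def hom_def
    using w0 root_char_mult[OF w]
    by (auto simp: carrier complex_units_explicit Fp_units_explicit(2)[OF prime] root_char_def)
  moreover have "root_char w x = 1" if "x \<in> index_subgroup p m" for x
  proof -
    have x: "x \<in> {1..int p - 1}" "[x ^ d = 1] (mod int p)"
      using that by (auto simp: index_subgroup unity_roots_mod_def)
    hence "[index x = 0] (mod m)" by (simp add: power_cong_one_iff)
    from power_cong_exponent[OF W_power(1)[OF w] this] show ?thesis using x(1) by (simp add: root_char_def)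
  qed
  moreover have "root_char w (int p - 1) = -1"
  proof -
    have "[int g ^ (M * d) = int p - 1] (mod int p)"
      using cong_trans[OF gpow_neg_one, of "int p - 1"] by (simp add: cong_iff_dvd_diff)
    hence "root_char w (int p - 1) = w ^ (M * d)" using p_gt_2 by (intro root_char_gpow[OF w]) auto
    also have "\<dots> = -1" using w odd_d by (simp add: W_def power_mult)
    finally show ?thesis .
  qed
  ultimately show ?thesis
    by (simp add: odd_chars_trivial_on_def chars_trivial_on_def Fp_units_explicit(3)[OF prime])
qed

lemma char_power:
  assumes "\<psi> \<in> mult_chars p" "x \<in> {1..int p - 1}"
  shows "\<psi> (x ^ k mod int p) = \<psi> x ^ k"
proof (induction k)
  case 0
  interpret G: group "Fp_units p" by (rule Fp_units_group[OF prime])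
  have one: "(1::int) \<in> {1..int p - 1}" using p_gt_2 by simp
  have "\<psi> (1 \<otimes>\<^bsub>Fp_units p\<^esub> 1) = \<psi> 1 * \<psi> 1" "\<psi> 1 \<noteq> 0"
    using assms(1) one by (auto simp: mult_chars_def hom_def carrier complex_units_explicit)
  hence "\<psi> 1 = 1" using p_gt_2 by (simp add: Fp_units_explicit(2)[OF prime])
  thus ?case using p_gt_2 by simp
next
  case (Suc k)
  have "x ^ k mod int p \<in> {1..int p - 1}"
  proof (induction k)
    case (Suc k)
    thus ?case using mult_closed[OF Suc assms(2)] by (simp add: mod_mult_right_eq mult.commute)
  qed (use p_gt_2 in simp)
  hence "\<psi> ((x ^ k mod int p) \<otimes>\<^bsub>Fp_units p\<^esub> x) = \<psi> (x ^ k mod int p) * \<psi> x"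
    using assms by (auto simp: mult_chars_def hom_def carrier complex_units_explicit)
  thus ?case by (simp add: Suc.IH Fp_units_explicit(2)[OF prime] mod_mult_right_eq mult.commute)
qed

text \<open>The inverse map is evaluation at the generator, reduced modulo p so as to lie in the
  carrier.\<close>

lemma bij_root_char: "bij_betw root_char W (odd_chars_trivial_on p m)"
proof -
  define g' where "g' = int g mod int p"
  have g': "g' \<in> {1..int p - 1}"
  proof -
    have "\<not> int p dvd int g" using g prime by (auto simp: residue_primroot_def prime_nat_iff dvd_imp_le coprime_def)
    hence "g' \<noteq> 0" by (simp add: g'_def dvd_eq_mod_eq_0)
    moreover have "0 \<le> g'" "g' < int p" using p_gt_2 by (simp_all add: g'_def)
    ultimately show ?thesis by simp
  qed
  have g'_pow: "g' ^ k mod int p = int g ^ k mod int p" for k by (simp add: g'_def power_mod)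
  show ?thesis
  proof (rule bij_betwI[where g = "\<lambda>\<psi>. \<psi> g'"])
    show "root_char \<in> W \<rightarrow> odd_chars_trivial_on p m" using root_char_mem by auto
    show "root_char w g' = w" if "w \<in> W" for w
      using root_char_gpow[OF that g', of 1] by (simp add: g'_def)
    have chi: "\<psi> x = \<psi> g' ^ i" if "\<psi> \<in> mult_chars p" "x \<in> {1..int p - 1}" "[int g ^ i = x] (mod int p)" for \<psi> x i
    proof -
      have "x = g' ^ i mod int p" using that(2,3) unfolding g'_pow by (simp add: Cong.cong_def)
      thus ?thesis using char_power[OF that(1) g'] by simp
    qed
    show "(\<lambda>\<psi>. \<psi> g') \<in> odd_chars_trivial_on p m \<rightarrow> W"
    proof
      fix \<psi> assume "\<psi> \<in> odd_chars_trivial_on p m"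
      hence \<psi>: "\<psi> \<in> mult_chars p" "\<And>x. x \<in> unity_roots_mod p d \<Longrightarrow> \<psi> x = 1" "\<psi> (int p - 1) = -1"
        by (auto simp: odd_chars_trivial_on_def chars_trivial_on_def index_subgroup Fp_units_explicit(3)[OF prime])
      define x where "x = int g ^ m mod int p"
      have x: "x = g' ^ m mod int p" by (simp add: x_def g'_pow)
      have "[(int g ^ m) ^ d = 1] (mod int p)"
        using gpow_cong_iff[of "m * d" 0] by (simp add: md power_mult[symmetric] cong_0_iff)
      hence "x \<in> unity_roots_mod p d"
        using unity_roots_mod_mult[OF prime, of "int g ^ m" d 1] d_pos by (simp add: x_def)
      hence "\<psi> g' ^ m = 1" using \<psi>(2)[of x] char_power[OF \<psi>(1) g', of m] x by simp
      moreover have "\<psi> (int p - 1) = \<psi> g' ^ (M * d)"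
      proof (rule chi[OF \<psi>(1)])
        show "[int g ^ (M * d) = int p - 1] (mod int p)"
          using cong_trans[OF gpow_neg_one, of "int p - 1"] by (simp add: cong_iff_dvd_diff)
      qed (use p_gt_2 in auto)
      \<comment> \<open>Writing d = 2k + 1 gives M d = m k + M, so w^m = 1 and w^(M d) = -1 together
        yield w^M = -1.\<close>
      moreover obtain k where k: "d = 2 * k + 1" using odd_d by (elim oddE)
      have "\<psi> g' ^ (M * d) = (\<psi> g' ^ m) ^ k * \<psi> g' ^ M"
        unfolding k m by (simp add: power_add[symmetric] power_mult[symmetric] algebra_simps)
      ultimately show "\<psi> g' \<in> W" using \<psi>(3) by (simp add: W_def)
    qed
    show "root_char (\<psi> g') = \<psi>" if "\<psi> \<in> odd_chars_trivial_on p m" for \<psi>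
    proof
      fix x
      have \<psi>: "\<psi> \<in> mult_chars p" using that by (simp add: odd_chars_trivial_on_def chars_trivial_on_def)
      show "root_char (\<psi> g') x = \<psi> x"
      proof (cases "x \<in> {1..int p - 1}")
        case True
        thus ?thesis using chi[OF \<psi> True cong_index[OF True]] by (simp add: root_char_def)
      next
        case False
        moreover have "\<psi> x = undefined" using \<psi> False unfolding mult_chars_def carrier by (auto intro: extensional_arb)
        ultimately show ?thesis by (simp only: root_char_def restrict_apply if_False)
      qed
    qed
  qed
qed

abbreviation "K n \<equiv> cot (pi * of_int n / p)"

lemma L_one_root_char:
  assumes w: "w \<in> W"
  shows "L_one p (root_char w) = of_real (pi / (2 * p)) * (\<Sum>x\<in>{1..int p - 1}. root_char w x * of_real (K x))"
proof -
  let ?f = "dirichlet_char p (root_char w)"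
  have "?f (p - x) = - ?f x" if x: "x \<in> {1..<p}" for x
  proof -
    have n: "\<not> p dvd x" "\<not> p dvd p - x" using x by (auto dest: dvd_imp_le)
    have xm: "int x mod int p = int x" "int (p - x) mod int p = int (p - x)" using x by (simp_all add: mod_pos_pos_trivial del: of_nat_diff)
    have xc: "int x \<in> {1..int p - 1}" "int p - 1 \<in> {1..int p - 1}" using x p_gt_2 by auto
    \<comment> \<open>This writes -x as (-1) x, so that the value -1 at p - 1 makes the Dirichlet
      character odd.\<close>
    have "int (p - x) = (int p - 1) * int x mod int p"
    proof -
      have "(int p - 1) * int x = int (p - x) + int p * (int x - 1)" using x by (simp add: algebra_simps of_nat_diff)
      thus ?thesis using xm(2) by (simp only: mod_mult_self2)
    qed
    hence "root_char w (int (p - x)) = root_char w (int p - 1) * root_char w (int x)"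
      using root_char_mult[OF w xc(2,1)] by simp
    moreover have "root_char w (int p - 1) = -1"
      using root_char_mem[OF w] by (simp add: odd_chars_trivial_on_def Fp_units_explicit(3)[OF prime])
    ultimately show ?thesis using n xm by (simp add: dirichlet_char_def)
  qed
  hence "(\<lambda>n. ?f (Suc n) / of_nat (Suc n)) sums
           (of_real (pi / (2 * p)) * (\<Sum>x\<in>{1..<p}. ?f x * of_real (cot (pi * x / p))))"
    using p_gt_2 by (intro sums_odd_periodic) (auto simp: dirichlet_char_def)
  hence "L_one p (root_char w) = of_real (pi / (2 * p)) * (\<Sum>x\<in>{1..<p}. ?f x * of_real (cot (pi * x / p)))"
    unfolding L_one_def by (simp add: sums_iff)
  also have "(\<Sum>x\<in>{1..<p}. ?f x * of_real (cot (pi * x / p))) = (\<Sum>x\<in>{1..int p - 1}. root_char w x * of_real (K x))"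
    by (rule sum.reindex_bij_witness[of _ nat int]) (auto simp: dirichlet_char_def dest: zdvd_imp_le dvd_imp_le)
  finally show ?thesis .
qed

lemma mult_cancel_units:
  assumes "y \<in> {1..int p - 1}" "x \<in> {1..int p - 1}" "z \<in> {1..int p - 1}" "x * y mod int p = z * y mod int p"
  shows "x = z"
proof -
  have "\<not> int p dvd y" using assms(1) zdvd_imp_le[of "int p" y] by auto
  hence "coprime y (int p)" using prime by (metis coprime_commute prime_imp_coprime prime_nat_int_transfer)
  moreover have "[x * y = z * y] (mod int p)" using assms(4) by (simp add: Cong.cong_def)
  ultimately have "[x = z] (mod int p)" by (simp add: cong_mult_rcancel)
  thus ?thesis using assms by (simp add: Cong.cong_def)
qed

text \<open>The square expands into a double sum over x and y. For fixed y the substitution x = z y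
  modulo p turns \<chi>(x) times the conjugate of \<chi>(y) into \<chi>(z).\<close>

lemma norm_L_one_square:
  assumes w: "w \<in> W"
  shows "of_real ((norm (L_one p (root_char w)))\<^sup>2)
    = of_real ((pi / (2 * p))\<^sup>2) * (\<Sum>z\<in>{1..int p - 1}. root_char w z * of_real (\<Sum>y\<in>{1..int p - 1}. K (z * y) * K y))"
proof -
  let ?I = "{1..int p - 1}" and ?r = "root_char w"
  have unit: "?r y * cnj (?r y) = 1" if "y \<in> ?I" for y
  proof -
    have "norm (?r y) = 1" using that W_power(3)[OF w] by (simp add: root_char_def norm_power)
    thus ?thesis by (simp add: complex_norm_square[symmetric])
  qed
  have bij: "bij_betw (\<lambda>z. z * y mod int p) ?I ?I" if y: "y \<in> ?I" for y
  proof -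
    have inj: "inj_on (\<lambda>z. z * y mod int p) ?I" using mult_cancel_units[OF y] by (auto intro!: inj_onI)
    moreover have "(\<lambda>z. z * y mod int p) ` ?I \<subseteq> ?I" using mult_closed y by blast
    ultimately show ?thesis using endo_inj_surj[of ?I] by (simp add: bij_betw_def)
  qed
  let ?S = "\<Sum>x\<in>?I. ?r x * of_real (K x)"
  have "?S * cnj ?S = (\<Sum>x\<in>?I. \<Sum>y\<in>?I. ?r x * of_real (K x) * (cnj (?r y) * of_real (K y)))"
    by (simp add: sum_product cnj_sum)
  also have "\<dots> = (\<Sum>y\<in>?I. \<Sum>x\<in>?I. ?r x * of_real (K x) * (cnj (?r y) * of_real (K y)))"
    by (rule sum.swap)
  also have "\<dots> = (\<Sum>y\<in>?I. \<Sum>z\<in>?I. ?r z * of_real (K (z * y) * K y))"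
  proof (rule sum.cong[OF refl])
    fix y assume y: "y \<in> ?I"
    have "(\<Sum>x\<in>?I. ?r x * of_real (K x) * (cnj (?r y) * of_real (K y)))
        = (\<Sum>z\<in>?I. ?r (z * y mod int p) * of_real (K (z * y mod int p)) * (cnj (?r y) * of_real (K y)))"
      by (rule sum.reindex_bij_betw[OF bij[OF y], symmetric])
    also have "\<dots> = (\<Sum>z\<in>?I. ?r z * of_real (K (z * y) * K y))"
    proof (intro sum.cong refl)
      fix z assume z: "z \<in> ?I"
      have "K (z * y mod int p) = K (z * y)" by (rule cot_pi_frac_cong) simp
      thus "?r (z * y mod int p) * of_real (K (z * y mod int p)) * (cnj (?r y) * of_real (K y))
          = ?r z * of_real (K (z * y) * K y)"
        using unit[OF y] root_char_mult[OF w z y] by (simp add: mult_ac)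
    qed
    finally show "(\<Sum>x\<in>?I. ?r x * of_real (K x) * (cnj (?r y) * of_real (K y)))
        = (\<Sum>z\<in>?I. ?r z * of_real (K (z * y) * K y))" .
  qed
  also have "\<dots> = (\<Sum>z\<in>?I. \<Sum>y\<in>?I. ?r z * of_real (K (z * y) * K y))" by (rule sum.swap)
  also have "\<dots> = (\<Sum>z\<in>?I. ?r z * of_real (\<Sum>y\<in>?I. K (z * y) * K y))"
    by (simp add: sum_distrib_left)
  finally have S: "?S * cnj ?S = (\<Sum>z\<in>?I. ?r z * of_real (\<Sum>y\<in>?I. K (z * y) * K y))" .
  have "of_real ((norm (L_one p ?r))\<^sup>2) = L_one p ?r * cnj (L_one p ?r)" by (rule complex_norm_square)
  also have "\<dots> = of_real ((pi / (2 * p))\<^sup>2) * (?S * cnj ?S)"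
    unfolding L_one_root_char[OF w] by (simp add: power2_eq_square)
  finally show ?thesis unfolding S .
qed

text \<open>Orthogonality leaves weight M on the subgroup H and -M on -H. The cotangent correlation
  is odd in z, so the two parts contribute equally; the total weight m cancels the 1/m of the
  moment.\<close>

theorem moment_eq:
  "moment 2 p m = pi\<^sup>2 / (2 * (real p)\<^sup>2) * (\<Sum>h\<in>unity_roots_mod p d. \<Sum>y\<in>{1..int p - 1}. K (h * y) * K y)"
proof -
  let ?I = "{1..int p - 1}"
  define C where "C = (\<lambda>z. \<Sum>y\<in>?I. K (z * y) * K y)"
  define e :: "int \<Rightarrow> real" where
    "e = (\<lambda>z. if [z ^ d = 1] (mod int p) then M else if [z ^ d = - 1] (mod int p) then - real M else 0)"
  have e: "(\<Sum>w\<in>W. root_char w z) = of_real (e z)" if z: "z \<in> ?I" for z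
  proof -
    have "(\<Sum>w\<in>W. root_char w z) = (\<Sum>w\<in>W. w ^ index z)" using z by (simp add: root_char_def)
    also have "\<dots> = of_real (e z)"
      unfolding W_def sum_powers_roots_neg_one[OF M_pos] e_def power_cong_one_iff[OF z] power_cong_neg_one_iff[OF z] m
      by simp
    finally show ?thesis .
  qed
  have "of_real (\<Sum>\<psi>\<in>odd_chars_trivial_on p m. (norm (L_one p \<psi>))\<^sup>2) = (\<Sum>w\<in>W. of_real ((norm (L_one p (root_char w)))\<^sup>2) :: complex)"
    by (simp add: sum.reindex_bij_betw[OF bij_root_char, symmetric])
  also have "\<dots> = of_real ((pi / (2 * p))\<^sup>2) * (\<Sum>w\<in>W. \<Sum>z\<in>?I. root_char w z * of_real (C z))"
    unfolding sum_distrib_left by (intro sum.cong refl) (simp only: norm_L_one_square C_def sum_distrib_left)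
  also have "(\<Sum>w\<in>W. \<Sum>z\<in>?I. root_char w z * of_real (C z)) = (\<Sum>z\<in>?I. \<Sum>w\<in>W. root_char w z * of_real (C z))"
    by (rule sum.swap)
  also have "\<dots> = (\<Sum>z\<in>?I. of_real (e z) * of_real (C z))"
    by (intro sum.cong refl) (simp add: e sum_distrib_right[symmetric])
  also have "of_real ((pi / (2 * p))\<^sup>2) * \<dots> = of_real ((pi / (2 * p))\<^sup>2 * (\<Sum>z\<in>?I. e z * C z))"
    by simp
  finally have sum_eq: "(\<Sum>\<psi>\<in>odd_chars_trivial_on p m. (norm (L_one p \<psi>))\<^sup>2) = (pi / (2 * p))\<^sup>2 * (\<Sum>z\<in>?I. e z * C z)"
    by (simp only: of_real_eq_iff)
  \<comment> \<open>These are H and -H, the latter because d is odd.\<close>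
  let ?T = "unity_roots_mod p d" and ?T' = "{z \<in> ?I. [z ^ d = - 1] (mod int p)}"
  have T: "?T = {z \<in> ?I. [z ^ d = 1] (mod int p)}" by (rule unity_roots_mod_def)
  have disj: "?T \<inter> ?T' = {}"
  proof -
    have "\<not> [1 = - 1] (mod int p)"
    proof
      assume "[1 = - 1] (mod int p)"
      hence "int p dvd 2" by (simp add: cong_iff_dvd_diff)
      thus False using zdvd_imp_le[of "int p" 2] p_gt_2 by simp
    qed
    thus ?thesis unfolding T by (auto dest: cong_trans[OF cong_sym])
  qed
  have fin: "finite ?T" "finite ?T'" unfolding T by (rule finite_subset[of _ ?I]; auto)+
  have odd_C: "C (int p - z) = - C z" for z
  proof -
    have "K ((int p - z) * y) = - K (z * y)" for y
      using cot_pi_frac_cong[of "(int p - z) * y" "- (z * y)" p]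
      by (simp add: cong_iff_dvd_diff algebra_simps flip: cot_minus)
    thus ?thesis by (simp add: C_def sum_negf)
  qed
  have neg: "[(int p - z) ^ d = - (z ^ d)] (mod int p)" for z
  proof -
    have "[(int p - z) ^ d = (- z) ^ d] (mod int p)" by (intro cong_pow) (simp add: cong_iff_dvd_diff)
    thus ?thesis using odd_d by simp
  qed
  have "(\<Sum>z\<in>?I. e z * C z) = (\<Sum>z\<in>?T \<union> ?T'. e z * C z)"
    by (rule sum.mono_neutral_right) (auto simp: T e_def)
  also have "\<dots> = (\<Sum>z\<in>?T. e z * C z) + (\<Sum>z\<in>?T'. e z * C z)"
    by (rule sum.union_disjoint[OF fin disj])
  also have "(\<Sum>z\<in>?T. e z * C z) = M * (\<Sum>z\<in>?T. C z)"
    unfolding sum_distrib_left by (intro sum.cong refl) (auto simp: T e_def)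
  also have "(\<Sum>z\<in>?T'. e z * C z) = - real M * (\<Sum>z\<in>?T'. C z)"
    unfolding sum_distrib_left
  proof (intro sum.cong refl)
    fix z assume z: "z \<in> ?T'"
    hence "z \<notin> ?T" using disj by blast
    hence "\<not> [z ^ d = 1] (mod int p)" using z by (simp add: T)
    thus "e z * C z = - real M * C z" using z by (simp add: e_def)
  qed
  \<comment> \<open>The reflection z \<mapsto> p - z carries -H to H and changes the sign of C,
    which compensates the negative weight.\<close>
  also have "(\<Sum>z\<in>?T'. C z) = (\<Sum>z\<in>?T. C (int p - z))"
  proof (rule sum.reindex_bij_witness[of _ "\<lambda>z. int p - z" "\<lambda>z. int p - z"])
    fix z assume "z \<in> ?T"
    thus "int p - z \<in> ?T'" using cong_trans[OF neg[of z], of "- 1"] by (auto simp: T cong_minus_minus_iff)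
  next
    fix z assume "z \<in> ?T'"
    thus "int p - z \<in> ?T" using cong_trans[OF neg[of z], of 1] cong_minus_minus_iff[of "z ^ d" "- 1" "int p"] by (auto simp: T)
  qed auto
  also have "(\<Sum>z\<in>?T. C (int p - z)) = - (\<Sum>z\<in>?T. C z)" by (simp add: odd_C sum_negf)
  finally have "(\<Sum>z\<in>?I. e z * C z) = m * (\<Sum>z\<in>?T. C z)" by (simp add: m)
  hence "moment 2 p m = 2 / m * ((pi / (2 * p))\<^sup>2 * (m * (\<Sum>z\<in>?T. C z)))"
    unfolding moment_def sum_eq by simp
  also have "\<dots> = pi\<^sup>2 / (2 * (real p)\<^sup>2) * (\<Sum>z\<in>?T. C z)"
    using M_pos m by (simp add: power_divide power_mult_distrib)
  finally show ?thesis unfolding C_def .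
qed

end

section \<open>The error term\<close>

context odd_index
begin

lemma abs_cot_symres_le:
  assumes "\<not> int p dvd n"
  shows "\<bar>K n\<bar> \<le> p / (pi * \<bar>symres p n\<bar>)"
proof -
  have p0: "real p > 0" using p_gt_2 by simp
  let ?s = "symres p n"
  have "K n = K ?s" by (rule cot_pi_frac_cong[OF cong_sym[OF cong_symres]])
  moreover have "?s \<noteq> 0"
  proof
    assume "?s = 0"
    thus False using cong_symres[of p n] assms by (metis cong_0_iff cong_sym)
  qed
  moreover have "2 * \<bar>real_of_int ?s\<bar> < p"
  proof -
    have "2 * \<bar>?s\<bar> < int p" using abs_symres_le[OF odd_p, of n] by linarith
    hence "real_of_int (2 * \<bar>?s\<bar>) < real_of_int (int p)" by linarith
    thus ?thesis by simp
  qed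
  ultimately have t: "0 < \<bar>pi * ?s / p\<bar>" "\<bar>pi * ?s / p\<bar> < pi / 2"
    using p0 by (simp_all add: abs_mult field_simps)
  have "\<bar>K ?s\<bar> \<le> 1 / \<bar>pi * ?s / p\<bar>" by (rule abs_cot_le[OF t])
  also have "\<dots> = p / (pi * \<bar>?s\<bar>)" using p0 by (simp add: abs_mult)
  finally show ?thesis using \<open>K n = K ?s\<close> by simp
qed

text \<open>Symmetry in y halves the range and absorbs the 1/2; bounding each cotangent by the
  reciprocal of its argument cancels all powers of pi and p.\<close>

lemma abs_correlation_le:
  assumes h: "h \<in> unity_roots_mod p d"
  shows "\<bar>pi\<^sup>2 / (2 * (real p)\<^sup>2) * (\<Sum>y\<in>{1..int p - 1}. K (h * y) * K y)\<bar>
    \<le> (\<Sum>k\<in>{1..(int p - 1) div 2}. 1 / (real_of_int k * \<bar>symres p (h * k)\<bar>))"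
proof -
  have p': "Factorial_Ring.prime (int p)" using prime by simp
  have neg: "K (a * (int p - y)) = - K (a * y)" for a y
    using cot_pi_frac_cong[of "a * (int p - y)" "- (a * y)" p]
    by (simp add: cong_iff_dvd_diff algebra_simps flip: cot_minus)
  have "(\<Sum>y\<in>{1..int p - 1}. K (h * y) * K y) = 2 * (\<Sum>k\<in>{1..(int p - 1) div 2}. K (h * k) * K k)"
    using neg[of h] neg[of 1] by (intro sum_int_symmetric[OF odd_p]) simp
  hence "\<bar>pi\<^sup>2 / (2 * (real p)\<^sup>2) * (\<Sum>y\<in>{1..int p - 1}. K (h * y) * K y)\<bar>
      = \<bar>\<Sum>k\<in>{1..(int p - 1) div 2}. (pi / p)\<^sup>2 * (K (h * k) * K k)\<bar>"
    unfolding sum_distrib_left[symmetric] by (simp add: power_divide)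
  also have "\<dots> \<le> (\<Sum>k\<in>{1..(int p - 1) div 2}. \<bar>(pi / p)\<^sup>2 * (K (h * k) * K k)\<bar>)"
    by (rule sum_abs)
  also have "\<dots> \<le> (\<Sum>k\<in>{1..(int p - 1) div 2}. 1 / (real_of_int k * \<bar>symres p (h * k)\<bar>))"
  proof (rule sum_mono)
    fix k assume k: "k \<in> {1..(int p - 1) div 2}"
    have k': "0 < k" "2 * k < int p" using k by auto
    have nk: "\<not> int p dvd k" using k' zdvd_imp_le[of "int p" k] by auto
    have "\<not> int p dvd h" using h zdvd_imp_le[of "int p" h] by (auto simp: unity_roots_mod_def)
    hence nhk: "\<not> int p dvd h * k" using nk p' by (simp add: prime_dvd_mult_iff)
    have "symres p k = k" using k' by (simp add: symres_def)
    hence "\<bar>K k\<bar> \<le> p / (pi * k)" using abs_cot_symres_le[OF nk] k' by simp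
    hence "\<bar>K (h * k)\<bar> * \<bar>K k\<bar> \<le> p / (pi * \<bar>symres p (h * k)\<bar>) * (p / (pi * k))"
      by (intro mult_mono abs_cot_symres_le[OF nhk]) auto
    hence "(pi / p)\<^sup>2 * (\<bar>K (h * k)\<bar> * \<bar>K k\<bar>) \<le> (pi / p)\<^sup>2 * (p / (pi * \<bar>symres p (h * k)\<bar>) * (p / (pi * k)))"
      by (intro mult_left_mono) auto
    also have "\<dots> = 1 / (real_of_int k * \<bar>symres p (h * k)\<bar>)"
      using p_gt_2 by (simp add: power2_eq_square)
    finally show "\<bar>(pi / p)\<^sup>2 * (K (h * k) * K k)\<bar> \<le> 1 / (real_of_int k * \<bar>symres p (h * k)\<bar>)"
      by (simp add: abs_mult)
  qed
  finally show ?thesis .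
qed

text \<open>With n = x|y|, the split 1/n = n^(-c) n^(-(1-c)) serves two purposes: n >= Q/2 turns the
  first factor into the saving Q^(-c), and the second makes the sum over h converge without losing a
  factor d.\<close>

lemma sum_inverse_heights_le:
  fixes c :: real and x y :: "int \<Rightarrow> int"
  defines "Q \<equiv> real p powr (1 / totient d)"
  assumes p32: "p > 32" and c: "0 < c" "c < 1"
    and x: "\<And>h. h \<in> unity_roots_mod p d - {1} \<Longrightarrow> 0 < x h"
    and y: "\<And>h. h \<in> unity_roots_mod p d - {1} \<Longrightarrow> y h \<noteq> 0"
    and coprime: "\<And>h. h \<in> unity_roots_mod p d - {1} \<Longrightarrow> coprime (x h) (y h)"
    and cong: "\<And>h. h \<in> unity_roots_mod p d - {1} \<Longrightarrow> [y h = h * x h] (mod int p)"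
  shows "(\<Sum>h\<in>unity_roots_mod p d - {1}. 1 / (x h * \<bar>y h\<bar>))
    \<le> 2 * Q powr (- c) * (2 / (1 - 2 powr (c - 1)) + d * real p powr (- ((1 - c) / (5 * sqrt d))))"
proof -
  let ?T = "unity_roots_mod p d - {1}"
  define n where "n = (\<lambda>h. real_of_int (x h * \<bar>y h\<bar>))"
  \<comment> \<open>The largest t with t^2 <= d, so that the (t + 1)^2 exponent pairs outnumber the
    d-th roots of unity.\<close>
  define t where "t = floor_sqrt d"
  have t: "t\<^sup>2 \<le> d" "d < (t + 1)\<^sup>2" "t > 0" using Suc_floor_sqrt_power2_gt[of d] d_pos by (auto simp: t_def)
  \<comment> \<open>This makes L^(4t) = p^(4/5), and p > 32 = 2^5 leaves room for the factor 2 in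
    the locale assumption.\<close>
  define L where "L = real p powr (1 / (5 * t))"
  have p0: "real p > 0" using p32 by simp
  have fin: "finite ?T" by (rule finite_subset[of _ "{1..int p - 1}"]) (auto simp: unity_roots_mod_def)
  have Q0: "Q > 0" using p0 by (simp add: Q_def)
  have tot: "totient d > 0" using d_pos by simp
  have n_ge1: "n h \<ge> real_of_int (x h)" "n h \<ge> real_of_int \<bar>y h\<bar>" if h: "h \<in> ?T" for h
  proof -
    have "x h * 1 \<le> x h * \<bar>y h\<bar>" using x[OF h] y[OF h] by (intro mult_left_mono) auto
    thus "n h \<ge> real_of_int (x h)" unfolding n_def by linarith
    have "1 * \<bar>y h\<bar> \<le> x h * \<bar>y h\<bar>" using x[OF h] by (intro mult_right_mono) auto
    thus "n h \<ge> real_of_int \<bar>y h\<bar>" unfolding n_def by linarith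
  qed
  have n_Q: "Q / 2 \<le> n h" if h: "h \<in> ?T" for h
  proof -
    have h': "h \<in> {1..int p - 1}" "[h ^ d = 1] (mod int p)" "h \<noteq> 1" using h by (auto simp: unity_roots_mod_def)
    have "\<not> [h = 1] (mod int p)"
    proof
      assume "[h = 1] (mod int p)"
      hence "h = 1" using h' p32 by (intro cong_less_imp_eq_int) auto
      thus False using h' by simp
    qed
    moreover have "\<not> int p dvd x h"
    proof
      assume *: "int p dvd x h"
      hence "int p dvd y h" using cong[OF h] by (metis cong_dvd_iff dvd_mult)
      hence "is_unit (int p)" using coprime_common_divisor[OF coprime[OF h] *] by simp
      thus False using p32 by auto
    qed
    ultimately have "real p \<le> (\<bar>x h\<bar> + \<bar>y h\<bar>) ^ totient d"
      by (intro prime_le_power_totient[OF prime odd_d h'(2) _ cong[OF h]])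
    \<comment> \<open>Both entries are nonzero integers, so each of x and |y| is at most their
      product.\<close>
    also have "\<dots> \<le> (2 * n h) ^ totient d"
      unfolding of_int_power using n_ge1[OF h] x[OF h] by (intro power_mono) auto
    finally have "Q \<le> ((2 * n h) ^ totient d) powr (1 / totient d)"
      unfolding Q_def using p0 by (intro powr_mono2) auto
    also have "\<dots> = 2 * n h"
    proof -
      have "0 < 2 * n h" using n_ge1[OF h] x[OF h] by linarith
      hence "(2 * n h) ^ totient d = (2 * n h) powr totient d" by (simp only: powr_realpow)
      thus ?thesis using tot \<open>0 < 2 * n h\<close> by (simp only: powr_powr) simp
    qed
    finally show ?thesis by simp
  qed
  have n0: "n h > 0" if h: "h \<in> ?T" for h using n_Q[OF h] Q0 by simp
  have inv_n: "1 / n h \<le> (Q / 2) powr (- c) * z powr (- (1 - c))" if h: "h \<in> ?T" and z: "0 < z" "z \<le> n h" for h z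
  proof -
    have "1 / n h = n h powr (- c) * n h powr (- (1 - c))"
    proof -
      have "n h powr (- c) * n h powr (- (1 - c)) = n h powr (- c + - (1 - c))" by (simp only: powr_add)
      also have "- c + - (1 - c) = - 1" by simp
      also have "n h powr (- 1) = 1 / n h" using n0[OF h] by (simp add: powr_minus_divide)
      finally show ?thesis ..
    qed
    also have "\<dots> \<le> (Q / 2) powr (- c) * z powr (- (1 - c))"
      using c n_Q[OF h] Q0 z n0[OF h] by (intro mult_mono powr_mono2') auto
    finally show ?thesis .
  qed
  define S where "S = {h \<in> ?T. x h \<le> L \<and> \<bar>y h\<bar> \<le> L}"
  have "S \<subseteq> ?T" by (auto simp: S_def)
  hence "(\<Sum>h\<in>?T. 1 / n h) = (\<Sum>h\<in>S. 1 / n h) + (\<Sum>h\<in>?T - S. 1 / n h)"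
    using sum.subset_diff[OF _ fin] by (metis add.commute)
  also have "(\<Sum>h\<in>S. 1 / n h) \<le> (Q / 2) powr (- c) * (2 / (1 - 2 powr (c - 1)))"
  proof -
    interpret unity_fractions p d t L S x y
    proof
      show "card (unity_roots_mod p d) < (t + 1)\<^sup>2"
        using card_unity_roots_mod_le[OF prime d_pos] t(2) by linarith
      have "L ^ (4 * t) = real p powr (4 / 5)"
        unfolding L_def using p0 t(3) by (simp add: powr_realpow[symmetric] powr_powr)
      moreover have "2 * real p powr (4 / 5) < p"
      proof -
        have "(2::real) = 32 powr (1 / 5)"
        proof -
          have "(32::real) = 2 powr 5" by (simp add: powr_numeral)
          thus ?thesis by (simp add: powr_powr)
        qed
        also have "\<dots> < real p powr (1 / 5)" using p32 by (intro powr_less_mono2) auto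
        finally have "2 * real p powr (4 / 5) < real p powr (1 / 5) * real p powr (4 / 5)"
          using p0 by (intro mult_strict_right_mono) auto
        also have "\<dots> = p" using p0 by (simp add: powr_add[symmetric])
        finally show ?thesis .
      qed
      ultimately show "2 * L ^ (4 * t) < p" by simp
    qed (use prime odd_p odd_d x y coprime cong in \<open>auto simp: S_def\<close>)
    obtain v :: "int \<Rightarrow> int" where v: "inj_on v S" "\<And>h. h \<in> S \<Longrightarrow> 2 ^ nat \<bar>v h\<bar> \<le> x h * \<bar>y h\<bar>"
      using exists_exponent by blast
    \<comment> \<open>The lower bound 2^|v| for n, raised to the power -(1-c), becomes w^|v|: a
      geometric series over the distinct values of v.\<close>
    define w :: real where "w = 2 powr (c - 1)"
    have w: "0 < w" "w < 1" using c powr_less_mono[of "c - 1" 0 2] by (simp_all add: w_def)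
    have "(\<Sum>h\<in>S. 1 / n h) \<le> (\<Sum>h\<in>S. (Q / 2) powr (- c) * w ^ nat \<bar>v h\<bar>)"
    proof (rule sum_mono)
      fix h assume h: "h \<in> S"
      have "real_of_int (2 ^ nat \<bar>v h\<bar>) \<le> n h" unfolding n_def using v(2)[OF h] by linarith
      hence "1 / n h \<le> (Q / 2) powr (- c) * (2 ^ nat \<bar>v h\<bar>) powr (- (1 - c))"
        using h by (intro inv_n) (auto simp: S_def)
      also have "(2 ^ nat \<bar>v h\<bar>) powr (- (1 - c)) = w ^ nat \<bar>v h\<bar>"
        unfolding w_def by (simp add: powr_realpow[symmetric] powr_powr mult.commute)
      finally show "1 / n h \<le> (Q / 2) powr (- c) * w ^ nat \<bar>v h\<bar>" .
    qed
    also have "\<dots> = (Q / 2) powr (- c) * (\<Sum>h\<in>S. w ^ nat \<bar>v h\<bar>)" by (simp add: sum_distrib_left)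
    also have "\<dots> \<le> (Q / 2) powr (- c) * (2 / (1 - w))"
      using fin by (intro mult_left_mono sum_powr_inj_le[OF w v(1)]) (auto simp: S_def)
    finally show ?thesis by (simp add: w_def)
  qed
  also have "(\<Sum>h\<in>?T - S. 1 / n h) \<le> (Q / 2) powr (- c) * (d * real p powr (- ((1 - c) / (5 * sqrt d))))"
  proof -
    have "1 / n h \<le> (Q / 2) powr (- c) * real p powr (- ((1 - c) / (5 * sqrt d)))" if h: "h \<in> ?T - S" for h
    proof -
      have "L \<le> n h" using h n_ge1[of h] by (auto simp: S_def)
      hence "1 / n h \<le> (Q / 2) powr (- c) * L powr (- (1 - c))"
        using h p0 by (intro inv_n) (auto simp: L_def)
      also have "L powr (- (1 - c)) = real p powr (- ((1 - c) / (5 * t)))"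
        unfolding L_def powr_powr by (simp add: minus_divide_left)
      \<comment> \<open>Since t <= sqrt d, a fraction outside \<open>S\<close> has n above p^(1/(5
        sqrt d)); at most d such terms occur.\<close>
      also have "\<dots> \<le> real p powr (- ((1 - c) / (5 * sqrt d)))"
      proof -
        have "real t \<le> sqrt d" using t(1) by (intro real_le_rsqrt) (metis of_nat_le_iff of_nat_power)
        thus ?thesis using c t(3) p32 d_pos by (intro powr_mono le_imp_neg_le divide_left_mono) auto
      qed
      finally show ?thesis by (simp add: mult_left_mono)
    qed
    hence "(\<Sum>h\<in>?T - S. 1 / n h) \<le> (\<Sum>h\<in>?T - S. (Q / 2) powr (- c) * real p powr (- ((1 - c) / (5 * sqrt d))))"
      by (rule sum_mono)
    also have "\<dots> = card (?T - S) * ((Q / 2) powr (- c) * real p powr (- ((1 - c) / (5 * sqrt d))))" by simp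
    also have "\<dots> \<le> d * ((Q / 2) powr (- c) * real p powr (- ((1 - c) / (5 * sqrt d))))"
    proof (intro mult_right_mono)
      have "card (?T - S) \<le> card (unity_roots_mod p d)"
        by (rule card_mono) (auto intro: finite_subset[of _ "{1..int p - 1}"] simp: unity_roots_mod_def)
      thus "real (card (?T - S)) \<le> real d" using card_unity_roots_mod_le[OF prime d_pos] by linarith
    qed auto
    finally show ?thesis by (simp add: mult_ac)
  qed
  also have "(Q / 2) powr (- c) * (2 / (1 - 2 powr (c - 1))) + (Q / 2) powr (- c) * (d * real p powr (- ((1 - c) / (5 * sqrt d))))
      = 2 powr c * Q powr (- c) * (2 / (1 - 2 powr (c - 1)) + d * real p powr (- ((1 - c) / (5 * sqrt d))))"
  proof -
    have "(Q / 2) powr (- c) = 2 powr c * Q powr (- c)"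
      using Q0 by (simp add: powr_divide powr_minus field_simps)
    thus ?thesis by (simp only: distrib_left)
  qed
  also have "\<dots> \<le> 2 * Q powr (- c) * (2 / (1 - 2 powr (c - 1)) + d * real p powr (- ((1 - c) / (5 * sqrt d))))"
  proof (intro mult_right_mono)
    show "2 powr c \<le> (2::real)" using c powr_mono[of c 1 2] by simp
    have "2 powr (c - 1) \<le> (1::real)" using c powr_mono[of "c - 1" 0 2] by simp
    thus "0 \<le> 2 / (1 - 2 powr (c - 1)) + d * real p powr (- ((1 - c) / (5 * sqrt d)))"
      by (intro add_nonneg_nonneg divide_nonneg_nonneg) auto
  qed auto
  finally show ?thesis by (simp add: n_def)
qed

text \<open>The term h = 1 is the main term and the others are bounded through their Thue fractions;
  6 is the 3 of \<open>sum_inverse_symres_le\<close> times the 2 of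
  \<open>sum_inverse_heights_le\<close>. For d = 1 there are no other terms, and a bound of size log
  p / sqrt p would be too weak against p^(-c) for c > 1/2.\<close>

lemma moment_error_le:
  fixes c :: real
  assumes p32: "p > 32" and c: "0 < c" "c < 1"
  shows "\<bar>moment 2 p m - pi\<^sup>2 / 6\<bar> \<le> 19 / p + (if d = 1 then 0 else
     6 * real p powr (- c / totient d) * (2 / (1 - 2 powr (c - 1)) + d * real p powr (- ((1 - c) / (5 * sqrt d))))
     + 2 * d * (1 + ln p) / sqrt p)"
proof -
  let ?T = "unity_roots_mod p d"
  define R where "R = (\<lambda>h. pi\<^sup>2 / (2 * (real p)\<^sup>2) * (\<Sum>y\<in>{1..int p - 1}. K (h * y) * K y))"
  have fin: "finite ?T" by (rule finite_subset[of _ "{1..int p - 1}"]) (auto simp: unity_roots_mod_def)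
  have one: "1 \<in> ?T" using p32 by (simp add: unity_roots_mod_def)
  have "moment 2 p m = (\<Sum>h\<in>?T. R h)" unfolding moment_eq R_def by (simp add: sum_distrib_left)
  also have "\<dots> = R 1 + (\<Sum>h\<in>?T - {1}. R h)" by (rule sum.remove[OF fin one])
  finally have eq: "moment 2 p m = R 1 + (\<Sum>h\<in>?T - {1}. R h)" .
  have R1: "\<bar>R 1 - pi\<^sup>2 / 6\<bar> \<le> 19 / p"
    using sum_cot_square[OF odd_p] p32 by (simp add: R_def power2_eq_square)
  show ?thesis
  proof (cases "d = 1")
    case True
    have "card ?T \<le> 1" using card_unity_roots_mod_le[OF prime d_pos] True by simp
    hence "?T = {1}" using one fin by (metis card_1_singletonE card_0_eq empty_iff le_antisym less_one linorder_not_less singletonD)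
    thus ?thesis using R1 eq True by simp
  next
    case False
    have "\<exists>xy. 0 < fst xy \<and> snd xy \<noteq> 0 \<and> coprime (fst xy) (snd xy) \<and> (fst xy)\<^sup>2 \<le> int p
        \<and> (snd xy)\<^sup>2 \<le> int p \<and> [snd xy = h * fst xy] (mod int p)" if h: "h \<in> ?T - {1}" for h
    proof -
      have "\<not> int p dvd h" using h zdvd_imp_le[of "int p" h] by (auto simp: unity_roots_mod_def)
      from Thue_coprime[OF prime this] show ?thesis by (metis fst_conv snd_conv)
    qed
    hence "\<exists>f. \<forall>h\<in>?T - {1}. 0 < fst (f h) \<and> snd (f h) \<noteq> 0 \<and> coprime (fst (f h)) (snd (f h)) \<and> (fst (f h))\<^sup>2 \<le> int p
        \<and> (snd (f h))\<^sup>2 \<le> int p \<and> [snd (f h) = h * fst (f h)] (mod int p)"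
      by (intro bchoice) blast
    then obtain f where f: "\<forall>h\<in>?T - {1}. 0 < fst (f h) \<and> snd (f h) \<noteq> 0 \<and> coprime (fst (f h)) (snd (f h)) \<and> (fst (f h))\<^sup>2 \<le> int p
        \<and> (snd (f h))\<^sup>2 \<le> int p \<and> [snd (f h) = h * fst (f h)] (mod int p)" ..
    define x y where "x = (\<lambda>h. fst (f h))" and "y = (\<lambda>h. snd (f h))"
    have xy: "0 < x h" "y h \<noteq> 0" "coprime (x h) (y h)" "(x h)\<^sup>2 \<le> int p" "(y h)\<^sup>2 \<le> int p" "[y h = h * x h] (mod int p)"
      if "h \<in> ?T - {1}" for h using f that unfolding x_def y_def by auto
    have Rh: "\<bar>R h\<bar> \<le> 3 * (1 / (x h * \<bar>y h\<bar>)) + 2 * (1 + ln p) / sqrt p" if h: "h \<in> ?T - {1}" for h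
    proof -
      have nh: "\<not> int p dvd h" using h zdvd_imp_le[of "int p" h] by (auto simp: unity_roots_mod_def)
      have "\<bar>R h\<bar> \<le> (\<Sum>k\<in>{1..(int p - 1) div 2}. 1 / (real_of_int k * \<bar>symres p (h * k)\<bar>))"
        unfolding R_def using h by (intro abs_correlation_le) auto
      also have "\<dots> \<le> 3 / (x h * \<bar>y h\<bar>) + 2 * (1 + ln p) / sqrt p"
        using sum_inverse_symres_le[OF prime odd_p nh xy[OF h]] by simp
      finally show ?thesis by simp
    qed
    have "\<bar>\<Sum>h\<in>?T - {1}. R h\<bar> \<le> (\<Sum>h\<in>?T - {1}. \<bar>R h\<bar>)" by (rule sum_abs)
    also have "\<dots> \<le> (\<Sum>h\<in>?T - {1}. 3 * (1 / (x h * \<bar>y h\<bar>)) + 2 * (1 + ln p) / sqrt p)"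
      by (rule sum_mono[OF Rh])
    also have "\<dots> = 3 * (\<Sum>h\<in>?T - {1}. 1 / (x h * \<bar>y h\<bar>)) + card (?T - {1}) * (2 * (1 + ln p) / sqrt p)"
      by (simp add: sum.distrib sum_distrib_left)
    also have "(\<Sum>h\<in>?T - {1}. 1 / (x h * \<bar>y h\<bar>))
        \<le> 2 * (real p powr (1 / totient d)) powr (- c) * (2 / (1 - 2 powr (c - 1)) + d * real p powr (- ((1 - c) / (5 * sqrt d))))"
      by (rule sum_inverse_heights_le[OF p32 c]) (use xy in auto)
    also have "(real p powr (1 / totient d)) powr (- c) = real p powr (- c / totient d)"
      by (simp add: powr_powr)
    also have "card (?T - {1}) * (2 * (1 + ln p) / sqrt p) \<le> d * (2 * (1 + ln p) / sqrt p)"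
    proof (rule mult_right_mono)
      have "card (?T - {1}) \<le> card ?T" using fin by (intro card_mono) auto
      thus "real (card (?T - {1})) \<le> real d" using card_unity_roots_mod_le[OF prime d_pos] by linarith
    qed (use p32 in simp)
    finally have "\<bar>\<Sum>h\<in>?T - {1}. R h\<bar> \<le> 6 * real p powr (- c / totient d) * (2 / (1 - 2 powr (c - 1)) + d * real p powr (- ((1 - c) / (5 * sqrt d))))
     + 2 * d * (1 + ln p) / sqrt p" by (simp add: algebra_simps)
    thus ?thesis using R1 eq False by simp
  qed
qed

end

section \<open>From the explicit error bound to the asymptotic statement\<close>

lemma odd_indexI:
  assumes "Factorial_Ring.prime p" "p > 2" "m dvd p - 1" "odd ((p - 1) div m)"
  obtains M g where "odd_index p m ((p - 1) div m) M g"
proof -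
  have "odd p" using assms(1,2) prime_odd_nat by blast
  have md: "m * ((p - 1) div m) = p - 1" using assms(3) by simp
  have "even (p - 1)" using \<open>odd p\<close> by simp
  hence "even m" using md assms(4) by (metis even_mult_iff)
  then obtain M where "m = 2 * M" by auto
  moreover obtain g where "residue_primroot p g" using prime_primitive_root_exists[of p] assms(1,2) by auto
  ultimately have "odd_index p m ((p - 1) div m) M g"
    using assms \<open>odd p\<close> md by unfold_locales auto
  thus ?thesis using that by blast
qed

text \<open>With l = ln p the exponential is p^(-a/sqrt d). As totient d >= d^(3/5), the exponent is
  at least a d^(1/10) in size, which beats the factor d.\<close>

lemma bounded_decay:
  fixes d :: nat and a l :: real
  assumes "odd d" "totient d \<le> l" "a > 0"
  shows "d * exp (- (a * l / sqrt d)) \<le> (10 / a) ^ 10"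
proof -
  have d0: "d > 0" using assms(1) by (auto intro: Nat.gr0I)
  \<comment> \<open>The tenth root makes every quantity an integral power: d = u^10, sqrt d = u^5,
    totient d >= u^6. Then exp(a u) >= (a u/10)^10.\<close>
  define u where "u = real d powr (1 / 10)"
  have u: "u > 0" "u ^ 10 = d" using d0 by (simp_all add: u_def powr_realpow[symmetric] powr_powr)
  have "(u ^ 6) ^ 5 = real (d ^ 3)" by (simp flip: u(2) power_mult)
  also have "\<dots> \<le> real (totient d ^ 5)" using odd_cube_le_totient_power5[OF assms(1)] by (simp only: of_nat_le_iff)
  finally have "(u ^ 6) ^ 5 \<le> real (totient d) ^ 5" by simp
  hence "u ^ 6 \<le> totient d" by (subst (asm) power_mono_iff) (use u(1) in auto)
  hence "u ^ 6 \<le> l" using assms(2) by linarith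
  moreover have "sqrt d = u ^ 5" using u by (intro real_sqrt_unique) (simp_all add: power_mult[symmetric])
  ultimately have "a * u \<le> a * l / sqrt d"
    using u(1) assms(3) by (simp add: pos_le_divide_eq mult.assoc power_Suc[symmetric] del: power_Suc)
  hence "exp (a * u) \<le> exp (a * l / sqrt d)" by simp
  moreover have "0 < a * u" using assms(3) u(1) by (rule mult_pos_pos)
  hence "(1 + a * u / 10) ^ 10 \<le> exp (a * u)"
    using exp_ge_one_plus_x_over_n_power_n[of 10 "a * u"] by simp
  moreover have "(a * u / 10) ^ 10 \<le> (1 + a * u / 10) ^ 10"
    using assms(3) u(1) by (intro power_mono) auto
  moreover have "(a * u / 10) ^ 10 = (a / 10) ^ 10 * d"
    using u(2) by (simp add: power_mult_distrib power_divide)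
  ultimately have "(a / 10) ^ 10 * d \<le> exp (a * l / sqrt d)" by linarith
  thus ?thesis using assms(3) by (simp add: exp_minus field_simps power_divide)
qed

text \<open>Used with l = ln p, so that d / sqrt p is smaller than any p^(-e) with e < 1/2, up to
  powers of ln p.\<close>

lemma real_le_square_ln:
  fixes d :: nat and l :: real
  assumes "odd d" "totient d \<le> l" "1 \<le> l"
  shows "real d \<le> l\<^sup>2"
proof -
  have "real d ^ 3 \<le> real (totient d) ^ 5"
    using odd_cube_le_totient_power5[OF assms(1)] by (metis of_nat_le_iff of_nat_power)
  also have "\<dots> \<le> l ^ 5" using assms(2) by (intro power_mono) auto
  also have "\<dots> \<le> l ^ 6" using assms(3) by (intro power_increasing) auto
  also have "\<dots> = (l\<^sup>2) ^ 3" by (simp flip: power_mult)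
  finally show ?thesis by (subst (asm) power_mono_iff) auto
qed

theorem theorem2p5:
  fixes F :: "'a filter" and p m :: "'a \<Rightarrow> nat" and c :: real
  assumes "filterlim p at_top F"
    and "\<forall>\<^sub>F i in F. Factorial_Ring.prime (p i) \<and> m i dvd p i - 1 \<and> odd ((p i - 1) div m i)"
    and "(\<lambda>i. real (totient ((p i - 1) div m i))) \<in> o[F](\<lambda>i. ln (real (p i)))"
    and "c < 1"
  shows "(\<lambda>i. moment 2 (p i) (m i) - pi\<^sup>2 / 6)
           \<in> O[F](\<lambda>i. real (p i) powr (- c / real (totient ((p i - 1) div m i))))"
proof -
  \<comment> \<open>The given c may be zero or negative, while \<open>moment_error_le\<close> wants
    an exponent in (0, 1). Enlarging c to b only strengthens the bound.\<close>
  define b where "b = max c (1 / 2)"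
  have b: "0 < b" "b < 1" "c \<le> b" using assms(4) by (auto simp: b_def)
  define a where "a = (1 - b) / 5"
  have a: "a > 0" using b by (simp add: a_def)
  \<comment> \<open>One summand for each error: 19 for the diagonal term, 6 times the height sum, 2
    for the log p / sqrt p term.\<close>
  define B where "B = 19 + 6 * (2 / (1 - 2 powr (b - 1)) + (10 / a) ^ 10) + 2"
  \<comment> \<open>Prepared for the log p / sqrt p term, where d is replaced by (ln p)^2.\<close>
  have "((\<lambda>x::real. (ln x)\<^sup>2 * (1 + ln x) * x powr (- ((1 - b) / 2))) \<longlongrightarrow> 0) at_top"
    using b by real_asymp
  hence "\<forall>\<^sub>F x::real in at_top. (ln x)\<^sup>2 * (1 + ln x) * x powr (- ((1 - b) / 2)) < 1"
    by (rule order_tendstoD) simp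
  hence "\<forall>\<^sub>F n in at_top. (ln (real n))\<^sup>2 * (1 + ln (real n)) * real n powr (- ((1 - b) / 2)) < 1"
    using filterlim_real_sequentially by (rule eventually_compose_filterlim)
  hence ev1: "\<forall>\<^sub>F i in F. (ln (real (p i)))\<^sup>2 * (1 + ln (real (p i))) * real (p i) powr (- ((1 - b) / 2)) < 1"
    using assms(1) by (rule eventually_compose_filterlim)
  have ev2: "\<forall>\<^sub>F i in F. p i > 32"
    using eventually_gt_at_top[of 32] assms(1) by (rule eventually_compose_filterlim)
  \<comment> \<open>The little-o hypothesis with constant 1: eventually totient d <= ln p, as
    \<open>bounded_decay\<close> and \<open>real_le_square_ln\<close> require.\<close>
  have ev3: "\<forall>\<^sub>F i in F. real (totient ((p i - 1) div m i)) \<le> \<bar>ln (real (p i))\<bar>"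
    using landau_o.smallD[OF assms(3), of 1] by simp
  show ?thesis
  proof (rule bigoI[of _ B])
    show "\<forall>\<^sub>F i in F. norm (moment 2 (p i) (m i) - pi\<^sup>2 / 6)
        \<le> B * norm (real (p i) powr (- c / real (totient ((p i - 1) div m i))))"
      using ev1 ev2 ev3 assms(2)
    proof eventually_elim
      case (elim i)
      define P d where "P = p i" and "d = (P - 1) div m i"
      have P32: "P > 32" and odd: "odd d" and tot: "real (totient d) \<le> ln (real P)"
        and asy: "(ln (real P))\<^sup>2 * (1 + ln (real P)) * real P powr (- ((1 - b) / 2)) < 1"
        using elim by (simp_all add: P_def d_def)
      obtain M g where "odd_index P (m i) d M g"
        using odd_indexI[of P "m i"] elim P32 unfolding P_def d_def by (metis numeral_less_iff order.strict_trans semiring_norm(76,78,81))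
      then interpret odd_index P "m i" d M g .
      have P0: "real P > 0" using P32 by simp
      have tot1: "totient d \<ge> 1" using d_pos by (simp add: Suc_leI)
      define Y where "Y = real P powr (- b / totient d)"
      have "exp 1 \<le> real P" using exp_le P32 by linarith
      hence ln1: "1 \<le> ln (real P)" using P0 by (simp add: ln_ge_iff)
      have Y0: "Y > 0" using P0 by (simp add: Y_def)
      have W: "0 < 2 / (1 - 2 powr (b - 1))"
        using b powr_less_mono[of "b - 1" 0 2] by simp
      have 1: "19 / P \<le> 19 * Y"
      proof -
        have "b / totient d \<le> 1" using b tot1 by (simp add: divide_le_eq)
        hence "real P powr (- 1) \<le> Y" unfolding Y_def using P32 by (intro powr_mono) auto
        thus ?thesis using P0 by (simp add: powr_minus divide_inverse)
      qed
      have 2: "2 / (1 - 2 powr (b - 1)) + d * real P powr (- ((1 - b) / (5 * sqrt d))) \<le> 2 / (1 - 2 powr (b - 1)) + (10 / a) ^ 10"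
      proof -
        have "real P powr (- ((1 - b) / (5 * sqrt d))) = exp (- (a * ln P / sqrt d))"
          using P0 by (simp add: powr_def a_def)
        thus ?thesis using bounded_decay[OF odd tot a] by simp
      qed
      \<comment> \<open>An odd d other than 1 has totient at least 2, so p^(-b/2) <= Y. The factor
        1/sqrt p is split accordingly into p^(-(1-b)/2), which absorbs d and the logarithm, and
        p^(-b/2).\<close>
      have 3: "2 * d * (1 + ln P) / sqrt P \<le> 2 * Y" if "d \<noteq> 1"
      proof -
        have "totient d \<ge> 2"
        proof -
          have "d \<ge> 3" using that odd d_pos by (metis One_nat_def Suc_leI le_neq_implies_less numeral_2_eq_2 numeral_3_eq_3 odd_one even_numeral)
          hence "totient d > 1" by (intro totient_gt_1) auto
          thus ?thesis by simp
        qed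
        hence "b / totient d \<le> b / 2" using b d_pos by (intro divide_left_mono) auto
        hence "real P powr (- b / 2) \<le> Y" unfolding Y_def using P32 by (intro powr_mono) auto
        have "d * (1 + ln P) / sqrt P \<le> (ln (real P))\<^sup>2 * (1 + ln P) / sqrt P"
          using real_le_square_ln[OF odd tot ln1] ln1 by (intro divide_right_mono mult_right_mono) auto
        also have "\<dots> = ((ln (real P))\<^sup>2 * (1 + ln P) * real P powr (- ((1 - b) / 2))) * real P powr (- b / 2)"
        proof -
          have "real P powr (1 / 2) = sqrt P" by (rule powr_half_sqrt) simp
          hence "1 / sqrt P = real P powr (- (1 / 2))" by (simp only: powr_minus inverse_eq_divide)
          moreover have "- (1 / 2) = - ((1 - b) / 2) + - b / 2" by (simp add: diff_divide_distrib)
          ultimately have "1 / sqrt P = real P powr (- ((1 - b) / 2)) * real P powr (- b / 2)" by (simp only: powr_add)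
          thus ?thesis by (simp only: divide_inverse mult.assoc mult_1_left)
        qed
        also have "\<dots> \<le> 1 * real P powr (- b / 2)" using asy by (intro mult_right_mono) auto
        also have "\<dots> \<le> Y" using \<open>real P powr (- b / 2) \<le> Y\<close> by simp
        finally show ?thesis by simp
      qed
      have "\<bar>moment 2 P (m i) - pi\<^sup>2 / 6\<bar> \<le> 19 / P + (if d = 1 then 0 else
         6 * Y * (2 / (1 - 2 powr (b - 1)) + d * real P powr (- ((1 - b) / (5 * sqrt d)))) + 2 * d * (1 + ln P) / sqrt P)"
        unfolding Y_def by (rule moment_error_le[OF P32 b(1,2)])
      also have "\<dots> \<le> 19 * Y + (6 * Y * (2 / (1 - 2 powr (b - 1)) + (10 / a) ^ 10) + 2 * Y)"
      proof (rule add_mono[OF 1])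
        have "6 * Y * (2 / (1 - 2 powr (b - 1)) + d * real P powr (- ((1 - b) / (5 * sqrt d))))
            \<le> 6 * Y * (2 / (1 - 2 powr (b - 1)) + (10 / a) ^ 10)"
          using 2 Y0 by (intro mult_left_mono) auto
        moreover have "0 \<le> 6 * Y * (2 / (1 - 2 powr (b - 1)) + (10 / a) ^ 10) + 2 * Y"
          using Y0 W a by (intro add_nonneg_nonneg mult_nonneg_nonneg) auto
        ultimately show "(if d = 1 then 0 else
         6 * Y * (2 / (1 - 2 powr (b - 1)) + d * real P powr (- ((1 - b) / (5 * sqrt d)))) + 2 * d * (1 + ln P) / sqrt P)
          \<le> 6 * Y * (2 / (1 - 2 powr (b - 1)) + (10 / a) ^ 10) + 2 * Y"
          using 3 by (cases "d = 1") (simp_all add: add_mono)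
      qed
      also have "\<dots> = B * Y" by (simp add: B_def algebra_simps)
      also have "\<dots> \<le> B * real P powr (- c / totient d)"
      proof (rule mult_left_mono)
        have "c / totient d \<le> b / totient d" using b(3) by (intro divide_right_mono) auto
        thus "Y \<le> real P powr (- c / totient d)" unfolding Y_def using P32 by (intro powr_mono) auto
        show "0 \<le> B" unfolding B_def using W a by (intro add_nonneg_nonneg mult_nonneg_nonneg) auto
      qed
      finally show ?case by (simp add: P_def d_def)
    qed
  qed
qed

end
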